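(* For every $n \geq 6$, the lattice $L_n$ equipped with the positive definite quadratic form $Q_n$ (the pair $[L_n, Q_n]$) is a local covering maximum, i.e. a local maximum of the covering density (equivalently, of the inhomogeneous Hermite invariant $\mu(Q)/(\det Q)^{1/n}$, where $\mu(Q)$ is the inhomogeneous minimum of $Q$, i.e. the squared covering radius).
   Context: For $n \geq 6$, let $L_n \subseteq \mathbb{R}^n$ be the lattice spanned by the root lattice $(\mathsf{D}_{n-1}, 0)$ (the lattice $\mathsf{D}_{n-1}=\{x\in\mathbb{Z}^{n-1}: \sum x_i \text{ even}\}$ embedded in the first $n-1$ coordinates) together with the vector $(-1/2, (1/2)^{n-2}, 1)$. Equip it with the quadratic form $Q_n[x] = x_1^2+\dots+x_{n-1}^2+\frac{n-3}{4}x_n^2$ if $n$ is even, and $Q_n[x] = x_1^2+\dots+x_{n-1}^2+\frac{n-5}{4}x_n^2$ if $n$ is odd. The pair is denoted $[L_n, Q_n]$. For $n=6,7$ these correspond to the lattices $\mathsf{E}_6$ and $\mathsf{E}_7$. *)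

theory Defs
  imports "HOL-Analysis.Analysis"
begin

text \<open>
  Quadratic forms are identified with their symmetric matrices, and the topology on forms is the
  one of \<^typ>\<open>real^'n^'n\<close>.
\<close>

definition qform :: "real^'n^'n \<Rightarrow> real^'n \<Rightarrow> real"
  where "qform Q x = x \<bullet> (Q *v x)"

definition pos_def_forms :: "(real^'n^'n) set"
  where "pos_def_forms = {Q. transpose Q = Q \<and> (\<forall>x. x \<noteq> 0 \<longrightarrow> qform Q x > 0)}"

definition int_vecs :: "(real^'n) set"
  where "int_vecs = {v. \<forall>i. v $ i \<in> \<int>}"

text \<open>
  For positive definite forms the supremum and the infimum below are attained.
\<close>

definition inhom_min :: "real^'n^'n \<Rightarrow> real"
  where "inhom_min Q = (SUP x. INF v\<in>int_vecs. qform Q (x - v))"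

definition inhom_hermite :: "real^'n^'n \<Rightarrow> real"
  where "inhom_hermite Q = inhom_min Q / root CARD('n) (det Q)"

text \<open>
  The volume of a ball of radius \<open>sqrt (inhom_min Q)\<close>, divided by the covolume \<open>sqrt (det Q)\<close>.
\<close>

definition covering_density :: "real^'n^'n \<Rightarrow> real"
  where "covering_density Q =
    unit_ball_vol (real CARD('n)) * sqrt (inhom_min Q ^ CARD('n) / det Q)"

definition local_max_form :: "(real^'n^'n \<Rightarrow> real) \<Rightarrow> real^'n^'n \<Rightarrow> bool"
  where "local_max_form f Q \<longleftrightarrow>
    Q \<in> pos_def_forms \<and> (\<forall>\<^sub>F Q' in at Q within pos_def_forms. f Q' \<le> f Q)"

definition lattice_basis :: "real^'n^'n \<Rightarrow> (real^'n) set \<Rightarrow> bool"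
  where "lattice_basis B L \<longleftrightarrow> invertible B \<and> L = (\<lambda>z. B *v z) ` int_vecs"

text \<open>
  A pair \<open>[L, Q]\<close> of a full-rank lattice and a form is represented, with respect to a basis of \<open>L\<close>
  (the columns of \<open>B\<close>), by the form \<open>transpose B ** Q ** B\<close> on the integer vectors. Two bases
  differ by a unimodular matrix, under which \<^const>\<open>inhom_min\<close> and \<^const>\<open>det\<close> are
  invariant, so the choice of \<open>B\<close> is irrelevant for the two invariants above.
\<close>

definition local_max_pair ::
    "(real^'n^'n \<Rightarrow> real) \<Rightarrow> (real^'n) set \<Rightarrow> real^'n^'n \<Rightarrow> bool"
  where "local_max_pair f L Q \<longleftrightarrow>
    (\<exists>B. lattice_basis B L \<and> local_max_form f (transpose B ** Q ** B))"

definition local_covering_max :: "(real^'n) set \<Rightarrow> real^'n^'n \<Rightarrow> bool"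
  where "local_covering_max L Q \<longleftrightarrow> local_max_pair covering_density L Q"

global_interpretation int_module: module "\<lambda>(k::int) (x::'a::real_vector). of_int k *\<^sub>R x"
  defines int_span = int_module.span
  by unfold_locales (simp_all add: algebra_simps)

text \<open>
  In the following definitions, \<open>e\<close> is an enumeration of the index type by \<open>{1..n}\<close> with
  \<open>n = CARD('n)\<close>, so that \<open>x $ e i\<close> is the \<open>i\<close>-th coordinate of \<open>x\<close>.
\<close>

definition D_root_lattice :: "(nat \<Rightarrow> 'n::finite) \<Rightarrow> (real^'n) set"
  where "D_root_lattice e =
    {x. (\<forall>i\<in>{1..CARD('n)-1}. x $ e i \<in> \<int>) \<and>
        (\<exists>k\<in>\<int>. (\<Sum>i=1..CARD('n)-1. x $ e i) = 2 * k) \<and>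
        x $ e CARD('n) = 0}"

definition glue_vec :: "(nat \<Rightarrow> 'n::finite) \<Rightarrow> real^'n"
  where "glue_vec e = (\<chi> j. if j = e 1 then -1/2 else if j = e CARD('n) then 1 else 1/2)"

definition L_lattice :: "(nat \<Rightarrow> 'n::finite) \<Rightarrow> (real^'n) set"
  where "L_lattice e = int_span (insert (glue_vec e) (D_root_lattice e))"

definition last_coeff :: "nat \<Rightarrow> real"
  where "last_coeff n = (if even n then (real n - 3) / 4 else (real n - 5) / 4)"

definition Q_mat :: "(nat \<Rightarrow> 'n::finite) \<Rightarrow> real^'n^'n"
  where "Q_mat e =
    (\<chi> i j. if i \<noteq> j then 0 else if i = e CARD('n) then last_coeff CARD('n) else 1)"

lemma qform_Q_mat:
  fixes e :: "nat \<Rightarrow> 'n::finite" and x :: "real^'n"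
  assumes e: "bij_betw e {1..CARD('n)} UNIV"
  shows "qform (Q_mat e) x =
    (\<Sum>i=1..CARD('n)-1. (x $ e i)\<^sup>2) + last_coeff CARD('n) * (x $ e CARD('n))\<^sup>2"
proof -
  let ?n = "CARD('n)"
  let ?g = "\<lambda>j. (if j = e ?n then last_coeff ?n else 1) * (x $ j)\<^sup>2"
  let ?c = "\<lambda>j. if j = e ?n then last_coeff ?n else 1"
  obtain m where m: "?n = Suc m"
    using gr0_implies_Suc[OF zero_less_card_finite] by blast
  have inj: "e i \<noteq> e ?n" if "i \<in> {1..m}" for i
  proof
    assume "e i = e ?n"
    then have "i = ?n"
      using bij_betw_imp_inj_on[OF e] that m by (intro inj_onD[of e "{1..?n}"]) simp_all
    then show False using that m by simp
  qed
  have mv: "(Q_mat e *v x) $ i = ?c i * x $ i" for i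
  proof -
    have "(Q_mat e *v x) $ i = (\<Sum>j\<in>UNIV. if j = i then ?c i * x $ i else 0)"
      unfolding matrix_vector_mult_def Q_mat_def vec_lambda_beta
      by (rule sum.cong) simp_all
    also have "\<dots> = ?c i * x $ i" by (subst sum.delta) simp_all
    finally show ?thesis .
  qed
  have "qform (Q_mat e) x = (\<Sum>j\<in>UNIV. ?g j)"
    unfolding qform_def inner_vec_def mv
    by (rule sum.cong) (simp_all only: inner_real_def power2_eq_square mult_ac)
  also have "\<dots> = (\<Sum>i\<in>{1..?n}. ?g (e i))"
    by (rule sum.reindex_bij_betw[OF e, symmetric])
  also have "{1..?n} = insert ?n {1..m}"
    by (simp only: m) (rule atLeastAtMostSuc_conv, simp)
  also have "(\<Sum>i\<in>insert ?n {1..m}. ?g (e i)) = ?g (e ?n) + (\<Sum>i=1..m. ?g (e i))"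
    by (rule sum.insert) (simp_all add: m)
  also have "(\<Sum>i=1..m. ?g (e i)) = (\<Sum>i=1..m. (x $ e i)\<^sup>2)"
    by (rule sum.cong) (simp_all only: inj if_False mult_1)
  also have "m = ?n - 1" using m by simp
  finally show ?thesis by (simp only: if_True refl add.commute)
qed

end

(*
Eutaxy and perfection of the Delaunay polytope around a deep hole make the covering radius drop
linearly in every direction except scaling. In Euclidean coordinates write a form near the identity
as s (1 + H) with trace H = 0 and a point near the hole c as c + w. For a vertex v = c + p, with
d = (1 + H) w, the squared distance divided by s is R + (H[p] - 2 d.p) + O(|w| |d|). If no nonzero
(H, d) makes all the brackets nonnegative, then by compactness the smallest bracket is at most
- eps |(H, d)|, which beats both the quadratic error and det (1 + H) = 1 + o(|H|). Points that are
not deep holes are harmless by continuity and compactness of a fundamental domain.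

For L_n, a point at height t in [0, 1] above layer 0 has lattice points of layers 0 and 1 nearby;
averaging the two squared distances with weights 1 - t and t gives a bound that is convex in the
distances of the coordinates to the integers, hence is maximal where these are all 0 or all 1/2.
So there is one deep hole up to lattice translations and negation. Its polytope consists of an
even half cube, a cross polytope below it, and an apex (n even) or a second cross polytope (n odd)
above it. The averages over the three layers force trace and height terms to vanish, and the moments
of order at most four of the even half cube force the rest of H and d to vanish.
*)
theory Submission imports Defs begin

section \<open>Forms and determinants\<close>

lemma qform_sum: "qform Q x = (\<Sum>i\<in>UNIV. \<Sum>j\<in>UNIV. Q $ i $ j * x $ i * x $ j)"
  unfolding qform_def inner_vec_def matrix_vector_mult_def
  by (simp add: sum_distrib_left mult_ac)

lemma qform_mat_1 [simp]: "qform (mat 1) x = (norm x)\<^sup>2"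
  by (simp add: qform_def power2_norm_eq_inner)

lemma tendsto_qform [tendsto_intros]:
  assumes "(f \<longlongrightarrow> A) F" "(g \<longlongrightarrow> x) F"
  shows "((\<lambda>z. qform (f z) (g z)) \<longlongrightarrow> qform A x) F"
  unfolding qform_sum by (intro tendsto_intros assms)

lemma tendsto_det [tendsto_intros]:
  fixes A :: "real^'n^'n"
  assumes "(f \<longlongrightarrow> A) F"
  shows "((\<lambda>z. det (f z)) \<longlongrightarrow> det A) F"
  unfolding det_def by (intro tendsto_intros assms)

lemma tendsto_trace [tendsto_intros]:
  fixes A :: "real^'n^'n"
  assumes "(f \<longlongrightarrow> A) F"
  shows "((\<lambda>z. trace (f z)) \<longlongrightarrow> trace A) F"
  unfolding trace_def by (intro tendsto_intros assms)

lemma tendsto_matrix_matrix_mult [tendsto_intros]: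
  fixes A :: "real^'n^'m" and B :: "real^'k^'n"
  assumes "(f \<longlongrightarrow> A) F" "(g \<longlongrightarrow> B) F"
  shows "((\<lambda>z. f z ** g z) \<longlongrightarrow> A ** B) F"
  unfolding matrix_matrix_mult_def by (intro tendsto_intros assms)

lemma det_scaleR: "det (c *\<^sub>R A) = c ^ CARD('n) * det (A :: real^'n^'n)"
  by (simp add: det_def prod.distrib sum_distrib_left mult.left_commute)

lemma inner_matrix_vector: "(A *v x) \<bullet> y = x \<bullet> (transpose A *v (y::real^'n))"
  by (metis dot_lmul_matrix vector_transpose_matrix)

text \<open>Differentiate the Leibniz formula term by term. A permutation other than the identity
  moves at least two indices, so after one factor is differentiated an off-diagonal entry of the
  identity matrix is still present and the term vanishes. The identity permutation contributes the
  trace.\<close>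

lemma has_derivative_det_at_mat_1:
  "((\<lambda>H :: real^'n^'n. det (mat 1 + H)) has_derivative trace) (at 0)"
proof -
  let ?I = "mat 1 :: real^'n^'n"
  have entry: "((\<lambda>H :: real^'n^'n. (?I + H) $ i $ j) has_derivative (\<lambda>H. H $ i $ j)) (at 0)" for i j
    by (auto intro!: derivative_eq_intros bounded_linear_imp_has_derivative
        bounded_linear_compose[OF bounded_linear_vec_nth bounded_linear_vec_nth])
  have "((\<lambda>H :: real^'n^'n. det (?I + H)) has_derivative
     (\<lambda>H. \<Sum>p | p permutes UNIV. of_int (sign p) *
        (\<Sum>i\<in>UNIV. H $ i $ p i * (\<Prod>j\<in>UNIV - {i}. (?I + 0) $ j $ p j)))) (at 0)"
    unfolding det_def by (intro derivative_intros entry)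
  moreover have "(\<Sum>p | p permutes UNIV. of_int (sign p) *
        (\<Sum>i\<in>UNIV. H $ i $ p i * (\<Prod>j\<in>UNIV - {i}. (?I + 0) $ j $ p j))) = trace H" for H
  proof -
    have zero: "(\<Prod>j\<in>UNIV - {i}. ?I $ j $ p j) = 0" if perm: "p permutes UNIV" and ne: "p \<noteq> id" for p i
    proof -
      obtain k where k: "p k \<noteq> k" using ne by (auto simp: fun_eq_iff)
      have "p (p k) \<noteq> p k" using k permutes_inj[OF perm] by (auto dest: injD)
      then obtain j where "j \<noteq> i" "p j \<noteq> j" using k by metis
      then show ?thesis by (intro prod_zero) (auto simp: mat_def intro!: bexI[of _ j])
    qed
    have "(\<Sum>p | p permutes UNIV. of_int (sign p) *
        (\<Sum>i\<in>UNIV. H $ i $ p i * (\<Prod>j\<in>UNIV - {i}. (?I + 0) $ j $ p j))) =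
      (\<Sum>p\<in>{id}. of_int (sign p) *
        (\<Sum>i\<in>UNIV. H $ i $ p i * (\<Prod>j\<in>UNIV - {i}. (?I + 0) $ j $ p j)))"
      by (rule sum.mono_neutral_right) (auto simp: zero permutes_id intro!: sum.neutral)
    also have "\<dots> = trace H" by (simp add: trace_def mat_def)
    finally show ?thesis .
  qed
  ultimately show ?thesis by (simp only:)
qed

section \<open>Local maxima from rigid deep holes\<close>

text \<open>The brackets are homogeneous of degree one in \<open>(H, d)\<close>, so a uniform gap on
  the compact set of normalized trace-free symmetric pairs extends to all nonzero pairs.\<close>

lemma rigid_gap:
  fixes P :: "(real^'n) set"
  assumes "finite P"
    and rigid: "\<And>H d. transpose H = H \<Longrightarrow> trace H = 0 \<Longrightarrow>
      (\<And>p. p \<in> P \<Longrightarrow> 0 \<le> qform H p - 2 * (d \<bullet> p)) \<Longrightarrow> H = 0 \<and> d = 0"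
  obtains \<epsilon> where "\<epsilon> > 0"
    "\<And>H d. transpose H = H \<Longrightarrow> trace H = 0 \<Longrightarrow> (H, d) \<noteq> 0 \<Longrightarrow>
      \<exists>p\<in>P. qform H p - 2 * (d \<bullet> p) \<le> - \<epsilon> * norm (H, d)"
proof -
  let ?q = "\<lambda>z p. qform (fst z) p - 2 * (snd z \<bullet> p)"
  \<comment> \<open>The sum of the negative parts replaces the minimum over \<open>P\<close>: it is
    visibly continuous, and by rigidity it is positive at every admissible nonzero pair.\<close>
  define f where "f z = (\<Sum>p\<in>P. max 0 (- ?q z p))" for z :: "(real^'n^'n) \<times> (real^'n)"
  define C where "C = sphere 0 1 \<inter> {z :: (real^'n^'n) \<times> (real^'n).
    transpose (fst z) = fst z \<and> trace (fst z) = 0}"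
  have pos: "f z > 0" if nz: "transpose (fst z) = fst z" "trace (fst z) = 0" "z \<noteq> 0" for z
  proof -
    have "\<exists>p\<in>P. ?q z p < 0"
    proof (rule ccontr)
      assume "\<not> ?thesis"
      then have "fst z = 0 \<and> snd z = 0"
        using nz by (intro rigid) (auto simp: not_less)
      then show False using nz(3) by (simp add: prod_eq_iff)
    qed
    then obtain p where p: "p \<in> P" "?q z p < 0" by blast
    have "0 < max 0 (- ?q z p)" using p by simp
    also have "\<dots> \<le> f z" unfolding f_def
      by (intro member_le_sum) (use p assms in auto)
    finally show ?thesis .
  qed
  have clo: "closed {z :: (real^'n^'n) \<times> (real^'n). transpose (fst z) = fst z \<and> trace (fst z) = 0}"
    unfolding vec_eq_iff transpose_def trace_def
    by (auto intro!: closed_Collect_conj closed_Collect_all closed_Collect_eq continuous_intros)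
  have "compact C" unfolding C_def by (intro compact_Int_closed clo) auto
  moreover have "continuous_on C f"
    unfolding f_def qform_sum by (intro continuous_intros)
  ultimately obtain \<epsilon>1 where e1: "\<epsilon>1 > 0" "\<And>z. z \<in> C \<Longrightarrow> \<epsilon>1 \<le> f z"
  proof (cases "C = {}")
    case False
    then obtain z0 where "z0 \<in> C" "\<And>z. z \<in> C \<Longrightarrow> f z0 \<le> f z"
      using continuous_attains_inf[OF \<open>compact C\<close> _ \<open>continuous_on C f\<close>] by blast
    moreover have "0 < f z0" using \<open>z0 \<in> C\<close> by (intro pos) (auto simp: C_def)
    ultimately show ?thesis using that by blast
  qed (auto intro: that[of 1])
  \<comment> \<open>If every negative part were at most \<epsilon>, the sum would be at most
    \<open>card P * \<epsilon>\<close>; the added 1 makes this strictly less than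
    \<epsilon>1.\<close>
  define \<epsilon> where "\<epsilon> = \<epsilon>1 / (real (card P) + 1)"
  have e: "\<epsilon> > 0" using e1 by (simp add: \<epsilon>_def)
  moreover have "\<exists>p\<in>P. qform H p - 2 * (d \<bullet> p) \<le> - \<epsilon> * norm (H, d)"
    if H: "transpose H = H" "trace H = 0" "(H, d) \<noteq> 0" for H d
  proof (rule ccontr)
    assume "\<not> ?thesis"
    then have big: "?q (H, d) p > - \<epsilon> * norm (H, d)" if "p \<in> P" for p
      using that by (auto simp: not_le)
    define r where "r = norm (H, d)"
    have r: "r > 0" using H(3) by (simp add: r_def)
    define z where "z = (1 / r) *\<^sub>R (H, d)"
    have sc: "?q z p = ?q (H, d) p / r" for p
      by (simp add: z_def qform_def diff_divide_distrib flip: scaleR_matrix_vector_assoc)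
    have "z \<in> C"
      using H r by (auto simp: C_def z_def r_def transpose_scalar trace_def
          simp flip: sum_divide_distrib scaleR_Pair)
    then have "\<epsilon>1 \<le> f z" by (rule e1)
    also have "f z \<le> (\<Sum>p\<in>P. \<epsilon>)"
      unfolding f_def
    proof (rule sum_mono)
      fix p assume "p \<in> P"
      then have "- \<epsilon> < ?q z p" using big[of p] r unfolding sc r_def[symmetric]
        by (simp add: pos_less_divide_eq)
      then show "max 0 (- ?q z p) \<le> \<epsilon>" using e by simp
    qed
    also have "\<dots> < \<epsilon>1" using e1(1) by (simp add: \<epsilon>_def field_simps)
    finally show False by simp
  qed
  ultimately show thesis using that by blast
qed

text \<open>The cross term is expressed through \<open>A *v w\<close> because this vector becomes
  the \<open>d\<close> of the rigidity condition.\<close>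

lemma qform_shift:
  assumes "transpose A = A"
  shows "qform A (w - p) = w \<bullet> (A *v w) - 2 * ((A *v w) \<bullet> p) + qform A (p::real^'n)"
proof -
  have "w \<bullet> (A *v p) = (A *v w) \<bullet> p"
    using inner_matrix_vector[of A w p] assms by simp
  then show ?thesis
    by (simp add: qform_def matrix_vector_mult_diff_distrib inner_diff_left inner_diff_right inner_commute)
qed

lemma qform_add: "qform (A + B) x = qform A x + qform B x"
  by (simp add: qform_def matrix_vector_mult_add_rdistrib inner_add_right)

lemma qform_scaleR: "qform (c *\<^sub>R A) x = c * qform A x"
  by (simp add: qform_def flip: scaleR_matrix_vector_assoc)

lemma qform_uminus: "qform A (- x) = qform A x"
  by (simp add: qform_sum)

text \<open>After the trace is normalized by scaling, rigidity yields a vertex whose squared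
  distance drops linearly in \<open>(H, d)\<close>, while the determinant changes only by o(|H|).
  The claim uses n-th powers so that no root occurs and both sides scale alike under
  \<open>N = s (1 + H)\<close>.\<close>

lemma hole_local_estimate:
  fixes c :: "real^'n" and V :: "(real^'n) set"
  assumes "finite V" "R > 0" and dist: "\<And>v. v \<in> V \<Longrightarrow> (norm (v - c))\<^sup>2 = R"
    and "V \<noteq> {}"
    and rigid: "\<And>H d. transpose H = H \<Longrightarrow> trace H = 0 \<Longrightarrow>
      (\<And>v. v \<in> V \<Longrightarrow> 0 \<le> qform H (v - c) - 2 * (d \<bullet> (v - c))) \<Longrightarrow> H = 0 \<and> d = 0"
  shows "\<forall>\<^sub>F (N, y) in nhds (mat 1, c). N \<in> pos_def_forms \<longrightarrow>
    (\<exists>v\<in>V. qform N (y - v) ^ CARD('n) \<le> R ^ CARD('n) * det N)"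
proof -
  let ?n = "CARD('n)"
  obtain \<epsilon> where e: "\<epsilon> > 0"
    "\<And>H d. transpose H = H \<Longrightarrow> trace H = 0 \<Longrightarrow> (H, d) \<noteq> 0 \<Longrightarrow>
      \<exists>p\<in>(\<lambda>v. v - c) ` V. qform H p - 2 * (d \<bullet> p) \<le> - \<epsilon> * norm (H, d)"
  proof (rule rigid_gap[of "(\<lambda>v. v - c) ` V"])
    show "H = 0 \<and> d = 0" if "transpose H = H" "trace H = 0"
      "\<And>p. p \<in> (\<lambda>v. v - c) ` V \<Longrightarrow> 0 \<le> qform H p - 2 * (d \<bullet> p)" for H d
      using that by (intro rigid) blast+
  qed (use \<open>finite V\<close> in auto)
  \<comment> \<open>Half of the gain \<epsilon> will pay for the term quadratic in \<open>w\<close>.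
    The other half equals \<open>R * \<eta>\<close>, and \<eta> is the tolerance allowed for the
    determinant.\<close>
  define \<eta> where "\<eta> = \<epsilon> / (2 * R)"
  have eta: "\<eta> > 0" using e \<open>R > 0\<close> by (simp add: \<eta>_def)
  obtain r where r: "r > 0" and det: "\<And>H :: real^'n^'n. norm H < r \<Longrightarrow>
      norm (det (mat 1 + H) - det (mat 1 + 0 :: real^'n^'n) - trace H) \<le> \<eta> * norm H"
    using has_derivative_det_at_mat_1[unfolded has_derivative_within_alt] eta
    by (metis (no_types, lifting) UNIV_I diff_zero)
  \<comment> \<open>Dividing by the mean of the diagonal makes \<open>H\<close> trace-free.\<close>
  define s where "s z = trace (fst z) / real ?n" for z :: "(real^'n^'n) \<times> (real^'n)"
  define H where "H z = (1 / s z) *\<^sub>R fst z - mat 1" for z :: "(real^'n^'n) \<times> (real^'n)"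
  have f1: "(fst \<longlongrightarrow> mat 1) (nhds (mat 1 :: real^'n^'n, c))"
    using tendsto_fst[OF filterlim_ident, of "(mat 1 :: real^'n^'n, c)"] by simp
  have f2: "(snd \<longlongrightarrow> c) (nhds (mat 1 :: real^'n^'n, c))"
    using tendsto_snd[OF filterlim_ident, of "(mat 1 :: real^'n^'n, c)"] by simp
  have ls: "(s \<longlongrightarrow> 1) (nhds (mat 1 :: real^'n^'n, c))"
    unfolding s_def by (rule tendsto_eq_intros f1 refl | simp add: trace_I)+
  have lH: "(H \<longlongrightarrow> 0) (nhds (mat 1 :: real^'n^'n, c))"
    unfolding H_def by (rule tendsto_eq_intros f1 ls refl | simp)+
  have lw: "((\<lambda>z. snd z - c) \<longlongrightarrow> 0) (nhds (mat 1 :: real^'n^'n, c))"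
    by (rule tendsto_eq_intros f2 refl | simp)+
  have "\<forall>\<^sub>F z in nhds (mat 1, c). s z > 0"
    by (rule order_tendstoD(1)[OF ls]) simp
  moreover have "\<forall>\<^sub>F z in nhds (mat 1, c). norm (H z) < r"
    using tendstoD[OF lH r] by (simp add: dist_norm)
  moreover have "\<forall>\<^sub>F z in nhds (mat 1 :: real^'n^'n, c). norm (snd z - c) < \<epsilon> / 2"
    using tendstoD[OF lw, of "\<epsilon> / 2"] e by (simp add: dist_norm)
  ultimately have "\<forall>\<^sub>F z in nhds (mat 1, c). fst z \<in> pos_def_forms \<longrightarrow>
    (\<exists>v\<in>V. qform (fst z) (snd z - v) ^ ?n \<le> R ^ ?n * det (fst z))"
  proof eventually_elim
    case (elim z)
    show ?case
    proof
      assume pd: "fst z \<in> pos_def_forms"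
      define A where "A = mat 1 + H z"
      define w where "w = snd z - c"
      \<comment> \<open>With \<open>d = A w\<close> in place of \<open>w\<close>, the linear term is
        exactly \<open>- 2 d.p\<close>; the only remainder is \<open>w.d\<close>, which is small
        relative to \<open>d\<close>.\<close>
      define d where "d = A *v w"
      have N: "fst z = s z *\<^sub>R A" using elim(1) by (simp add: A_def H_def)
      have symA: "transpose A = A"
        using pd by (simp add: A_def H_def transpose_scalar pos_def_forms_def)
      have symH: "transpose (H z) = H z"
        using pd by (simp add: H_def pos_def_forms_def vec_eq_iff transpose_def mat_def)
      have "trace (fst z) = s z * real ?n" by (simp add: s_def)
      then have trH: "trace (H z) = 0"
        using elim(1) by (simp add: H_def trace_sub trace_I)
           (simp add: trace_def flip: sum_divide_distrib)
      obtain v where v: "v \<in> V" "qform (H z) (v - c) - 2 * (d \<bullet> (v - c)) \<le> - \<epsilon> * norm (H z, d)"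
      proof (cases "(H z, d) = 0")
        case True
        then show ?thesis using that \<open>V \<noteq> {}\<close> by (auto simp: qform_def zero_prod_def)
      next
        case False
        then show ?thesis using e(2)[OF symH trH] that by blast
      qed
      define Q where "Q = qform A (snd z - v)"
      have shift: "snd z - v = w - (v - c)" by (simp add: w_def)
      have qA: "qform A (v - c) = R + qform (H z) (v - c)"
        using dist[OF v(1)] by (simp add: A_def qform_add)
      have "Q = w \<bullet> d - 2 * (d \<bullet> (v - c)) + (R + qform (H z) (v - c))"
        using qA by (simp only: Q_def shift qform_shift[OF symA] d_def)
      also have "\<dots> \<le> R - \<epsilon> * norm (H z, d) + norm w * norm d"
        using v(2) norm_cauchy_schwarz[of w d] by simp
      also have "norm w * norm d \<le> \<epsilon> / 2 * norm (H z, d)"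
        using elim(3) e(1) norm_snd_le[of d "H z"] by (intro mult_mono) (auto simp: w_def)
      also have "R - \<epsilon> * norm (H z, d) + \<epsilon> / 2 * norm (H z, d) = R - \<epsilon> / 2 * norm (H z, d)"
        by simp
      also have "\<dots> \<le> R - \<epsilon> / 2 * norm (H z)"
        using e(1) norm_fst_le[of "H z" d] by simp
      also have "\<dots> = R * (1 - \<eta> * norm (H z))"
        using \<open>R > 0\<close> by (simp add: \<eta>_def field_simps)
      finally have Q: "Q \<le> R * (1 - \<eta> * norm (H z))" by simp
      have qN: "qform (fst z) (snd z - v) = s z * Q"
        by (simp add: N Q_def qform_scaleR)
      \<comment> \<open>Nonnegativity of \<open>Q\<close> is needed to raise the estimate to the
        n-th power; it also shows that the base \<open>1 - \<eta> * norm (H z)\<close> is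
        nonnegative.\<close>
      have "qform (fst z) (snd z - v) \<ge> 0"
        using pd by (cases "snd z - v = 0") (auto simp: pos_def_forms_def qform_def less_imp_le)
      then have Q0: "Q \<ge> 0" using elim(1) by (simp add: qN zero_le_mult_iff)
      with Q have le: "0 \<le> R * (1 - \<eta> * norm (H z))" by linarith
      then have le': "0 \<le> 1 - \<eta> * norm (H z)" using \<open>R > 0\<close> by (simp only: zero_le_mult_iff) simp
      have "Q ^ ?n \<le> (R * (1 - \<eta> * norm (H z))) ^ ?n" by (rule power_mono[OF Q Q0])
      also have "\<dots> = R ^ ?n * (1 - \<eta> * norm (H z)) ^ ?n" by (rule power_mult_distrib)
      \<comment> \<open>The base lies in [0, 1], so its n-th power is at most the base itself. As
        the trace of \<open>H\<close> is zero, the first-order expansion then bounds the base by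
        \<open>det A\<close>.\<close>
      also have "(1 - \<eta> * norm (H z)) ^ ?n \<le> 1 - \<eta> * norm (H z)"
        using power_decreasing[of 1 ?n "1 - \<eta> * norm (H z)"] le' eta by (simp add: Suc_leI)
      also have "\<dots> \<le> det A"
        using det[OF elim(2)] trH by (simp add: A_def abs_le_iff)
      finally have "Q ^ ?n \<le> R ^ ?n * det A" using \<open>R > 0\<close> by simp
      then have "s z ^ ?n * Q ^ ?n \<le> s z ^ ?n * (R ^ ?n * det A)"
        using elim(1) by (intro mult_left_mono) auto
      then have "qform (fst z) (snd z - v) ^ ?n \<le> R ^ ?n * det (fst z)"
        unfolding qN by (simp add: N det_scaleR power_mult_distrib mult_ac)
      then show "\<exists>v\<in>V. qform (fst z) (snd z - v) ^ ?n \<le> R ^ ?n * det (fst z)"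
        using v(1) by blast
    qed
  qed
  then show ?thesis by (simp add: case_prod_unfold)
qed

section \<open>From neighbourhoods of points to all of space: compactness and lattice
  periodicity\<close>

lemma eventually_ball_compact:
  assumes "compact K" "\<And>y. y \<in> K \<Longrightarrow> \<forall>\<^sub>F (x, y) in nhds (x0, y). P x y"
  shows "\<forall>\<^sub>F x in nhds x0. \<forall>y\<in>K. P x y"
proof -
  have "\<forall>y\<in>K. \<exists>W. open W \<and> (x0, y) \<in> W \<and> (\<forall>(x, y)\<in>W. P x y)"
    using assms(2) by (auto simp: eventually_nhds)
  then obtain W where W: "\<And>y. y \<in> K \<Longrightarrow> open (W y) \<and> (x0, y) \<in> W y \<and> (\<forall>(x, y)\<in>W y. P x y)"
    by metis
  \<comment> \<open>Tube lemma: an open set that contains the slice over \<open>x0\<close> contains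
    a full product neighbourhood of it.\<close>
  obtain X where "x0 \<in> X" "open X" "X \<times> K \<subseteq> (\<Union>y\<in>K. W y)"
    using Elementary_Topology.tube_lemma[OF assms(1), of "\<Union>y\<in>K. W y" x0] W by blast
  then show ?thesis unfolding eventually_nhds using W by (intro exI[of _ X]) blast
qed

lemma qform_nonneg: "M \<in> pos_def_forms \<Longrightarrow> 0 \<le> qform M x"
  by (cases "x = 0") (auto simp: pos_def_forms_def qform_def less_imp_le)

lemma qform_congruence: "qform (transpose S ** M ** S) x = qform M (S *v x)"
proof -
  have "x \<bullet> (transpose S *v y) = (S *v x) \<bullet> y" for y by (simp add: inner_matrix_vector)
  then show ?thesis by (simp add: qform_def flip: matrix_vector_mul_assoc)
qed

lemma pos_def_congruence:
  assumes "M \<in> pos_def_forms" "invertible (S :: real^'n^'n)"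
  shows "transpose S ** M ** S \<in> pos_def_forms"
proof -
  have "S *v x \<noteq> 0" if "x \<noteq> 0" for x
    using assms(2) that by (metis invertible_def matrix_left_invertible_ker)
  then show ?thesis using assms
    by (auto simp: pos_def_forms_def qform_congruence matrix_transpose_mul matrix_mul_assoc)
qed

lemma mat_1_pos_def: "mat 1 \<in> pos_def_forms"
  by (simp add: pos_def_forms_def transpose_mat)

text \<open>Real suprema and infima are informative only for nonempty bounded sets. Positive
  definiteness bounds the inner infima from below, and the covering hypothesis bounds the outer
  supremum from above.\<close>

lemma inhom_min_bounds:
  fixes M :: "real^'n^'n"
  assumes "M \<in> pos_def_forms" "\<And>x. \<exists>v\<in>int_vecs. qform M (x - v) \<le> r"
  shows "inhom_min M \<le> r" "0 \<le> inhom_min M"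
    "(INF v\<in>int_vecs. qform M (x - v)) \<le> inhom_min M"
proof -
  have bdd: "bdd_below ((\<lambda>v. qform M (x - v)) ` int_vecs)" for x
    using qform_nonneg[OF assms(1)] by (intro bdd_belowI[of _ 0]) auto
  have ne: "int_vecs \<noteq> ({} :: (real^'n) set)"
    using assms(2)[of 0] by blast
  have le: "(INF v\<in>int_vecs. qform M (x - v)) \<le> r" for x
    using assms(2)[of x] cINF_lower[OF bdd] by (meson order_trans)
  show "inhom_min M \<le> r"
    unfolding inhom_min_def by (intro cSUP_least le) simp
  show ub: "(INF v\<in>int_vecs. qform M (x - v)) \<le> inhom_min M" for x
    unfolding inhom_min_def by (intro cSUP_upper bdd_aboveI[of _ r]) (use le in auto)
  have "0 \<le> (INF v\<in>int_vecs. qform M (0 - v))"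
    using qform_nonneg[OF assms(1)] ne by (intro cINF_greatest) auto
  then show "0 \<le> inhom_min M" using ub[of 0] by linarith
qed

lemma int_vecs_closed:
  "u \<in> int_vecs \<Longrightarrow> v \<in> int_vecs \<Longrightarrow> u + v \<in> int_vecs"
  "u \<in> int_vecs \<Longrightarrow> v \<in> int_vecs \<Longrightarrow> u - v \<in> int_vecs"
  by (auto simp: int_vecs_def)

text \<open>Each point \<open>y\<close> is treated locally: a strict inequality at \<open>y\<close>
  persists by continuity, and a deep hole is moved to \<open>c\<close> by a lattice translation or a
  point reflection, where the local estimate applies. Compactness of a fundamental domain makes the
  neighbourhood of the identity uniform.\<close>

lemma eventually_covered:
  fixes S :: "real^'n^'n"
  assumes inv: "invertible S" and \<Lambda>: "\<Lambda> = (\<lambda>z. S *v z) ` int_vecs"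
    and "R > 0" "finite V" "V \<noteq> {}" "V \<subseteq> \<Lambda>"
    and dist: "\<And>v. v \<in> V \<Longrightarrow> (norm (v - c))\<^sup>2 = R"
    and cover: "\<And>x. (\<exists>v\<in>\<Lambda>. (norm (x - v))\<^sup>2 < R) \<or> (\<exists>u\<in>\<Lambda>. x = u + c \<or> x = u - c)"
    and rigid: "\<And>H d. transpose H = H \<Longrightarrow> trace H = 0 \<Longrightarrow>
      (\<And>v. v \<in> V \<Longrightarrow> 0 \<le> qform H (v - c) - 2 * (d \<bullet> (v - c))) \<Longrightarrow> H = 0 \<and> d = 0"
  shows "\<forall>\<^sub>F N in nhds (mat 1). N \<in> pos_def_forms \<longrightarrow>
    (\<forall>x. \<exists>v\<in>\<Lambda>. qform N (x - v) ^ CARD('n) \<le> R ^ CARD('n) * det N)"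
proof -
  let ?n = "CARD('n)"
  define P where "P N y \<longleftrightarrow> N \<in> pos_def_forms \<longrightarrow>
    (\<exists>v\<in>\<Lambda>. qform N (y - v) ^ ?n \<le> R ^ ?n * det N)" for N y
  have add: "u + v \<in> \<Lambda>" and diff: "u - v \<in> \<Lambda>" if "u \<in> \<Lambda>" "v \<in> \<Lambda>" for u v
    using that unfolding \<Lambda>
    by (auto simp flip: matrix_vector_right_distrib matrix_vector_mult_diff_distrib
        intro: int_vecs_closed)
  obtain T where T: "S ** T = mat 1" using inv unfolding invertible_def by blast
  have ev_c: "\<forall>\<^sub>F (N, y) in nhds (mat 1, c). N \<in> pos_def_forms \<longrightarrow>
    (\<exists>v\<in>V. qform N (y - v) ^ ?n \<le> R ^ ?n * det N)"
    by (rule hole_local_estimate) fact+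
  have f1: "(fst \<longlongrightarrow> mat 1) (nhds (mat 1 :: real^'n^'n, y))" for y :: "real^'n"
    using tendsto_fst[OF filterlim_ident, of "(mat 1 :: real^'n^'n, y)"] by simp
  have f2: "(snd \<longlongrightarrow> y) (nhds (mat 1 :: real^'n^'n, y))" for y :: "real^'n"
    using tendsto_snd[OF filterlim_ident, of "(mat 1 :: real^'n^'n, y)"] by simp
  have ev: "\<forall>\<^sub>F (N, y) in nhds (mat 1, y). P N y" for y
  proof -
    consider (strict) v where "v \<in> \<Lambda>" "(norm (y - v))\<^sup>2 < R"
      | (plus) u where "u \<in> \<Lambda>" "y = u + c" | (minus) u where "u \<in> \<Lambda>" "y = u - c"
      using cover[of y] by blast
    then show ?thesis
    proof cases
      case strict
      have "((\<lambda>z. R ^ ?n * det (fst z) - qform (fst z) (snd z - v) ^ ?n) \<longlongrightarrow>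
        R ^ ?n * det (mat 1 :: real^'n^'n) - qform (mat 1) (y - v) ^ ?n) (nhds (mat 1, y))"
        by (intro tendsto_intros f1 f2)
      moreover have "((norm (y - v))\<^sup>2) ^ ?n < R ^ ?n"
        using strict(2) by (intro power_strict_mono) auto
      ultimately have "\<forall>\<^sub>F z in nhds (mat 1, y).
          0 < R ^ ?n * det (fst z) - qform (fst z) (snd z - v) ^ ?n"
        by (intro order_tendstoD(1)) auto
      then show ?thesis
        by eventually_elim (use strict(1) in \<open>auto simp: P_def intro!: bexI[of _ v]\<close>)
    next
      case plus
      have "((\<lambda>z. (fst z, snd z - u)) \<longlongrightarrow> (mat 1, y - u)) (nhds (mat 1 :: real^'n^'n, y))"
        by (intro tendsto_intros f1 f2)
      then have "filterlim (\<lambda>z. (fst z, snd z - u)) (nhds (mat 1, c)) (nhds (mat 1 :: real^'n^'n, y))"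
        using plus(2) by simp
      from eventually_compose_filterlim[OF ev_c this] show ?thesis
      proof eventually_elim
        case (elim z)
        show ?case unfolding P_def case_prod_unfold
        proof
          assume "fst z \<in> pos_def_forms"
          with elim obtain v where "v \<in> V"
            "qform (fst z) (snd z - u - v) ^ ?n \<le> R ^ ?n * det (fst z)" by auto
          then show "\<exists>v\<in>\<Lambda>. qform (fst z) (snd z - v) ^ ?n \<le> R ^ ?n * det (fst z)"
            using add[OF plus(1)] \<open>V \<subseteq> \<Lambda>\<close> by (intro bexI[of _ "u + v"]) (auto simp: diff_diff_eq)
        qed
      qed
    next
      case minus
      \<comment> \<open>The reflection \<open>y \<mapsto> u - y\<close> preserves the lattice and
        every form, and takes \<open>u - c\<close> to \<open>c\<close>.\<close>
      have "((\<lambda>z. (fst z, u - snd z)) \<longlongrightarrow> (mat 1, u - y)) (nhds (mat 1 :: real^'n^'n, y))"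
        by (intro tendsto_intros f1 f2)
      then have "filterlim (\<lambda>z. (fst z, u - snd z)) (nhds (mat 1, c)) (nhds (mat 1 :: real^'n^'n, y))"
        using minus(2) by simp
      from eventually_compose_filterlim[OF ev_c this] show ?thesis
      proof eventually_elim
        case (elim z)
        show ?case unfolding P_def case_prod_unfold
        proof
          assume "fst z \<in> pos_def_forms"
          with elim obtain v where v: "v \<in> V"
            "qform (fst z) (u - snd z - v) ^ ?n \<le> R ^ ?n * det (fst z)" by auto
          have "qform (fst z) (u - snd z - v) = qform (fst z) (- (snd z - (u - v)))"
            by (simp add: algebra_simps)
          also have "\<dots> = qform (fst z) (snd z - (u - v))" by (rule qform_uminus)
          finally show "\<exists>v\<in>\<Lambda>. qform (fst z) (snd z - v) ^ ?n \<le> R ^ ?n * det (fst z)"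
            using v diff[OF minus(1)] \<open>V \<subseteq> \<Lambda>\<close> by (intro bexI[of _ "u - v"]) auto
        qed
      qed
    qed
  qed
  \<comment> \<open>A closed fundamental parallelepiped; subtracting the lattice vector with the
    floors of the coordinates moves any point into it.\<close>
  define K where "K = (\<lambda>z. S *v z) ` cbox 0 (vec 1)"
  have "compact K" unfolding K_def
    by (intro compact_continuous_image matrix_vector_mult_linear_continuous_on compact_cbox)
  then have "\<forall>\<^sub>F N in nhds (mat 1). \<forall>y\<in>K. P N y"
    by (rule eventually_ball_compact) (rule ev)
  then show ?thesis
  proof eventually_elim
    case (elim N)
    show ?case
    proof (intro impI allI)
      fix x assume pd: "N \<in> pos_def_forms"
      define z where "z = T *v x"
      define f where "f = (\<chi> i. real_of_int \<lfloor>z $ i\<rfloor>)"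
      have x: "x = S *v z" by (simp add: z_def matrix_vector_mul_assoc T)
      have f: "S *v f \<in> \<Lambda>" by (auto simp: \<Lambda> f_def int_vecs_def)
      have "0 \<le> z $ i - of_int \<lfloor>z $ i\<rfloor>" "z $ i - of_int \<lfloor>z $ i\<rfloor> \<le> 1" for i
        by linarith+
      then have "z - f \<in> cbox 0 (vec 1)" by (simp add: mem_box_cart f_def)
      then have "x - S *v f \<in> K"
        unfolding K_def x by (auto simp flip: matrix_vector_mult_diff_distrib)
      then obtain v where "v \<in> \<Lambda>" "qform N (x - S *v f - v) ^ ?n \<le> R ^ ?n * det N"
        using elim pd by (auto simp: P_def)
      then show "\<exists>v\<in>\<Lambda>. qform N (x - v) ^ ?n \<le> R ^ ?n * det N"
        using add[OF f] by (intro bexI[of _ "S *v f + v"]) (auto simp: diff_diff_eq)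
    qed
  qed
qed

text \<open>A change of basis turns forms near \<open>transpose S ** S\<close> into forms near the
  identity. The covering estimate then says
  \<open>inhom_min M \<le> R * root n (det M / det M0)\<close>, with equality at \<open>M0\<close>,
  and both invariants are monotone consequences of this.\<close>

theorem local_max_of_rigid_hole:
  fixes S :: "real^'n^'n"
  assumes inv: "invertible S" and \<Lambda>: "\<Lambda> = (\<lambda>z. S *v z) ` int_vecs"
    and "R > 0" "finite V" "V \<noteq> {}" "V \<subseteq> \<Lambda>"
    and dist: "\<And>v. v \<in> V \<Longrightarrow> (norm (v - c))\<^sup>2 = R"
    and hole: "\<And>v. v \<in> \<Lambda> \<Longrightarrow> R \<le> (norm (c - v))\<^sup>2"
    and cover: "\<And>x. (\<exists>v\<in>\<Lambda>. (norm (x - v))\<^sup>2 < R) \<or> (\<exists>u\<in>\<Lambda>. x = u + c \<or> x = u - c)"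
    and rigid: "\<And>H d. transpose H = H \<Longrightarrow> trace H = 0 \<Longrightarrow>
      (\<And>v. v \<in> V \<Longrightarrow> 0 \<le> qform H (v - c) - 2 * (d \<bullet> (v - c))) \<Longrightarrow> H = 0 \<and> d = 0"
  shows "local_max_form covering_density (transpose S ** S)"
    and "local_max_form inhom_hermite (transpose S ** S)"
proof -
  let ?n = "CARD('n)" and ?M0 = "transpose S ** S"
  obtain T where T: "S ** T = mat 1" "T ** S = mat 1" using inv unfolding invertible_def by blast
  \<comment> \<open>The form \<open>M\<close> read in Euclidean coordinates; the base point
    \<open>transpose S ** S\<close> becomes the identity.\<close>
  define g where "g M = transpose T ** M ** T" for M
  have detST: "det S * det T = 1" using T(1) by (metis det_I det_mul)
  have det0: "det ?M0 = (det S)\<^sup>2" by (simp add: det_mul power2_eq_square)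
  have det0_pos: "det ?M0 > 0" using detST by (auto simp: det0)
  have det_g: "det (g M) = det M / det ?M0" for M
  proof -
    have "det S \<noteq> 0" using detST by auto
    moreover from this have "det T = 1 / det S" using detST by (simp add: field_simps)
    ultimately show ?thesis by (simp add: g_def det_mul det0 power2_eq_square)
  qed
  have invT: "invertible T" using T unfolding invertible_def by blast
  have pd0: "?M0 \<in> pos_def_forms"
    using pos_def_congruence[OF mat_1_pos_def inv] by simp
  have "transpose T ** transpose S = mat 1"
    using T(1) by (metis matrix_transpose_mul transpose_mat)
  moreover have "g ?M0 = (transpose T ** transpose S) ** (S ** T)"
    by (simp add: g_def matrix_mul_assoc)
  ultimately have g0: "g ?M0 = mat 1" using T(1) by simp
  have lg: "(g \<longlongrightarrow> mat 1) (nhds ?M0)"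
    unfolding g0[symmetric] g_def by (intro tendsto_intros filterlim_ident)
  have "\<forall>\<^sub>F N in nhds (mat 1). N \<in> pos_def_forms \<longrightarrow>
    (\<forall>x. \<exists>v\<in>\<Lambda>. qform N (x - v) ^ ?n \<le> R ^ ?n * det N)"
    by (rule eventually_covered[where S = S]) fact+
  from eventually_compose_filterlim[OF this lg]
  have ev: "\<forall>\<^sub>F M in nhds ?M0. g M \<in> pos_def_forms \<longrightarrow>
    (\<forall>x. \<exists>v\<in>\<Lambda>. qform (g M) (x - v) ^ ?n \<le> R ^ ?n * det (g M))" .
  have qg: "qform (g M) (S *v x) = qform M x" for M x
    unfolding g_def qform_congruence by (simp add: matrix_vector_mul_assoc T)
  have "\<forall>\<^sub>F M in nhds ?M0. det M > 0"
    by (rule order_tendstoD(1)[OF tendsto_det[OF filterlim_ident] det0_pos])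
  with ev have ev': "\<forall>\<^sub>F M in nhds ?M0. M \<in> pos_def_forms \<longrightarrow>
     det M > 0 \<and> 0 \<le> inhom_min M \<and> inhom_min M \<le> R * root ?n (det M / det ?M0) \<and>
     (\<forall>x. (INF v\<in>int_vecs. qform M (x - v)) \<le> inhom_min M)"
  proof eventually_elim
    case (elim M)
    show ?case
    proof
      assume pd: "M \<in> pos_def_forms"
      let ?r = "R * root ?n (det M / det ?M0)"
      have r0: "0 \<le> ?r" using elim(2) det0_pos \<open>R > 0\<close> by simp
      have r_pow: "?r ^ ?n = R ^ ?n * det (g M)"
        using elim(2) det0_pos by (simp add: power_mult_distrib real_root_pow_pos det_g)
      have cov: "\<exists>v\<in>int_vecs. qform M (x - v) \<le> ?r" for x
      proof -
        obtain v where v: "v \<in> int_vecs"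
            "qform (g M) (S *v x - S *v v) ^ ?n \<le> R ^ ?n * det (g M)"
          using elim(1) pos_def_congruence[OF pd invT] unfolding g_def[symmetric] \<Lambda> by blast
        have "qform (g M) (S *v x - S *v v) = qform M (x - v)"
          unfolding matrix_vector_mult_diff_distrib[symmetric] qg ..
        with v(2) have "qform M (x - v) ^ ?n \<le> ?r ^ ?n" using r_pow by simp
        then have "qform M (x - v) \<le> ?r"
          using r0 qform_nonneg[OF pd] by simp
        with v(1) show ?thesis by blast
      qed
      show "det M > 0 \<and> 0 \<le> inhom_min M \<and> inhom_min M \<le> ?r \<and>
        (\<forall>x. (INF v\<in>int_vecs. qform M (x - v)) \<le> inhom_min M)"
        using inhom_min_bounds[OF pd cov] elim(2) by blast
    qed
  qed
  \<comment> \<open>The upper bound is the estimate evaluated at the base point itself. The lower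
    bound is witnessed by \<open>T *v c\<close>, the hole in basis coordinates, whose sphere is
    empty by \<open>hole\<close>.\<close>
  have R: "inhom_min ?M0 = R"
  proof (rule antisym)
    show "inhom_min ?M0 \<le> R"
      using eventually_nhds_x_imp_x[OF ev'] pd0 det0_pos by simp
    have "R \<le> (INF v\<in>int_vecs. qform ?M0 (T *v c - v))"
    proof (rule cINF_greatest)
      have "0 \<in> int_vecs" by (simp add: int_vecs_def)
      then show "int_vecs \<noteq> {}" by blast
      fix v :: "real^'n" assume "v \<in> int_vecs"
      then have "S *v v \<in> \<Lambda>" by (simp add: \<Lambda>)
      have "qform ?M0 (T *v c - v) = qform (mat 1) (S *v (T *v c - v))"
        using qform_congruence[of S "mat 1"] by simp
      also have "S *v (T *v c - v) = c - S *v v"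
        by (simp add: matrix_vector_mult_diff_distrib matrix_vector_mul_assoc T)
      finally show "R \<le> qform ?M0 (T *v c - v)" using hole[OF \<open>S *v v \<in> \<Lambda>\<close>] by simp
    qed
    also have "\<dots> \<le> inhom_min ?M0"
      using eventually_nhds_x_imp_x[OF ev'] pd0 by blast
    finally show "R \<le> inhom_min ?M0" .
  qed
  have "\<forall>\<^sub>F M in nhds ?M0. M \<in> pos_def_forms \<longrightarrow> inhom_hermite M \<le> inhom_hermite ?M0"
    using ev'
  proof (rule eventually_mono, intro impI)
    fix M :: "real^'n^'n" assume "M \<in> pos_def_forms \<longrightarrow>
     det M > 0 \<and> 0 \<le> inhom_min M \<and> inhom_min M \<le> R * root ?n (det M / det ?M0) \<and>
     (\<forall>x. (INF v\<in>int_vecs. qform M (x - v)) \<le> inhom_min M)" "M \<in> pos_def_forms"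
    then have *: "det M > 0" "inhom_min M \<le> R * root ?n (det M / det ?M0)" by blast+
    have "inhom_hermite M \<le> R * root ?n (det M / det ?M0) / root ?n (det M)"
      unfolding inhom_hermite_def using * by (intro divide_right_mono) auto
    also have "\<dots> = inhom_hermite ?M0"
      unfolding inhom_hermite_def R using * by (simp add: real_root_divide)
    finally show "inhom_hermite M \<le> inhom_hermite ?M0" .
  qed
  then show "local_max_form inhom_hermite ?M0"
    using pd0 by (auto simp: local_max_form_def eventually_at_filter elim: eventually_mono)
  have "\<forall>\<^sub>F M in nhds ?M0. M \<in> pos_def_forms \<longrightarrow> covering_density M \<le> covering_density ?M0"
    using ev'
  proof (rule eventually_mono, intro impI)
    fix M :: "real^'n^'n" assume "M \<in> pos_def_forms \<longrightarrow>
     det M > 0 \<and> 0 \<le> inhom_min M \<and> inhom_min M \<le> R * root ?n (det M / det ?M0) \<and>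
     (\<forall>x. (INF v\<in>int_vecs. qform M (x - v)) \<le> inhom_min M)" "M \<in> pos_def_forms"
    then have *: "det M > 0" "0 \<le> inhom_min M" "inhom_min M \<le> R * root ?n (det M / det ?M0)"
      by blast+
    have "inhom_min M ^ ?n \<le> (R * root ?n (det M / det ?M0)) ^ ?n"
      by (intro power_mono *)
    also have "\<dots> = R ^ ?n * (det M / det ?M0)"
      using * det0_pos by (simp add: power_mult_distrib real_root_pow_pos)
    finally have "inhom_min M ^ ?n / det M \<le> R ^ ?n / det ?M0"
      using * det0_pos by (simp add: field_simps)
    then show "covering_density M \<le> covering_density ?M0"
      unfolding covering_density_def R
      by (intro mult_left_mono) auto
  qed
  then show "local_max_form covering_density ?M0"
    using pd0 by (auto simp: local_max_form_def eventually_at_filter elim: eventually_mono)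
qed

section \<open>Moments of the even half cube\<close>

definition cube_sign :: "'a set \<Rightarrow> 'a \<Rightarrow> real"
  where "cube_sign S i = (if i \<in> S then -1 else 1)"

text \<open>Each set stands for a vertex of the even half cube, namely the sign vector that is
  negative exactly on it.\<close>

definition even_subsets :: "'a set \<Rightarrow> 'a set set"
  where "even_subsets I = {S. S \<subseteq> I \<and> even (card S)}"

lemma cube_sign_square [simp]: "cube_sign S i * cube_sign S i = 1"
  by (simp add: cube_sign_def)

lemma finite_even_subsets: "finite I \<Longrightarrow> finite (even_subsets I)"
  by (auto simp: even_subsets_def intro: finite_subset[of _ "Pow I"])

lemma card_even_subsets_pos: "finite I \<Longrightarrow> card (even_subsets I) > 0"
  using finite_even_subsets by (subst card_gt_0_iff) (auto simp: even_subsets_def intro!: exI[of _ "{}"])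

lemma prod_cube_sign:
  assumes "finite I" "S \<subseteq> I"
  shows "(\<Prod>i\<in>I. cube_sign S i) = (-1) ^ card S"
proof -
  have "(\<Prod>i\<in>I. cube_sign S i) = (\<Prod>i\<in>S. cube_sign S i) * (\<Prod>i\<in>I - S. cube_sign S i)"
    by (simp add: prod.subset_diff[OF assms(2,1)] mult.commute)
  then show ?thesis by (simp add: cube_sign_def)
qed

text \<open>Evenness becomes a product condition, so its invariance under sign changes is a
  computation with products.\<close>

lemma even_subsets_iff:
  assumes "finite I"
  shows "S \<in> even_subsets I \<longleftrightarrow> S \<subseteq> I \<and> (\<Prod>i\<in>I. cube_sign S i) = 1"
  using prod_cube_sign[OF assms] by (auto simp: even_subsets_def minus_one_power_iff split: if_splits)

(* Flipping one sign inside W and one outside W preserves evenness and negates the product. *)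
lemma sum_prod_cube_sign_eq_0:
  assumes "finite I" "W \<subseteq> I" "W \<noteq> {}" "W \<noteq> I"
  shows "(\<Sum>S\<in>even_subsets I. \<Prod>i\<in>W. cube_sign S i) = 0"
proof -
  obtain i j where ij: "i \<in> W" "j \<in> I" "j \<notin> W" using assms by blast
  define h where "h S = (S - {i, j}) \<union> ({i, j} - S)" for S
  define f where "f k = (if k = i \<or> k = j then -1 else 1 :: real)" for k
  have sg: "cube_sign (h S) k = f k * cube_sign S k" for S k
    by (auto simp: cube_sign_def h_def f_def)
  have "finite W" using assms finite_subset by blast
  have "i \<in> I" "i \<noteq> j" using ij assms by auto
  have prodI: "(\<Prod>k\<in>I. f k) = 1"
  proof -
    have "(\<Prod>k\<in>I. f k) = (\<Prod>k\<in>{i, j}. f k)"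
      using \<open>i \<in> I\<close> ij assms(1) by (intro prod.mono_neutral_right) (auto simp: f_def)
    then show ?thesis using \<open>i \<noteq> j\<close> by (simp add: f_def)
  qed
  have prodW: "(\<Prod>k\<in>W. f k) = -1"
  proof -
    have "(\<Prod>k\<in>W. f k) = (\<Prod>k\<in>{i}. f k)"
      using ij \<open>finite W\<close> by (intro prod.mono_neutral_right) (auto simp: f_def)
    then show ?thesis by (simp add: f_def)
  qed
  have hE: "h S \<in> even_subsets I" if "S \<in> even_subsets I" for S
    using that \<open>i \<in> I\<close> \<open>j \<in> I\<close> unfolding even_subsets_iff[OF assms(1)] sg prod.distrib prodI
    by (auto simp: h_def)
  have "bij_betw h (even_subsets I) (even_subsets I)"
    by (rule bij_betw_byWitness[where f' = h]) (use hE in \<open>auto simp: h_def\<close>)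
  from sum.reindex_bij_betw[OF this, of "\<lambda>S. \<Prod>k\<in>W. cube_sign S k"]
  show ?thesis unfolding sg prod.distrib prodW by (simp add: sum_negf)
qed

section \<open>Moments up to order four and recovery of the coefficients of a quadratic
  polynomial\<close>

context
  fixes I :: "'a set"
  assumes fin: "finite I" and card_I: "card I \<ge> 5"
begin

text \<open>At most four distinct coordinates cannot exhaust \<open>I\<close>, which has at least
  five, so the monomial can be negated by a sign change that preserves evenness.\<close>

lemma cube_moment_list:
  assumes "distinct xs" "set xs \<subseteq> I" "xs \<noteq> []" "length xs < 5"
  shows "(\<Sum>S\<in>even_subsets I. \<Prod>i\<leftarrow>xs. cube_sign S i) = 0"
proof -
  have "set xs \<noteq> I" using assms card_I distinct_card[OF assms(1)] by auto
  then have "(\<Sum>S\<in>even_subsets I. \<Prod>i\<in>set xs. cube_sign S i) = 0"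
    using assms by (intro sum_prod_cube_sign_eq_0 fin) auto
  then show ?thesis by (simp add: prod.distinct_set_conv_list[OF assms(1)])
qed

lemma cube_moment_1: "i \<in> I \<Longrightarrow> (\<Sum>S\<in>even_subsets I. cube_sign S i) = 0"
  using cube_moment_list[of "[i]"] by simp

lemma cube_moment_2:
  assumes "i \<in> I" "j \<in> I"
  shows "(\<Sum>S\<in>even_subsets I. cube_sign S i * cube_sign S j) =
    real (card (even_subsets I)) * of_bool (i = j)"
  using cube_moment_list[of "[i, j]"] assms by auto

lemma cube_moment_3:
  assumes "i \<in> I" "j \<in> I" "k \<in> I"
  shows "(\<Sum>S\<in>even_subsets I. cube_sign S i * cube_sign S j * cube_sign S k) = 0"
proof -
  have *: "cube_sign S p * (cube_sign S q * cube_sign S p) = cube_sign S q" for S :: "'a set" and p q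
    by (simp add: cube_sign_def)
  have **: "cube_sign S p * (cube_sign S p * x) = x" for S :: "'a set" and p x
    by (simp flip: mult.assoc)
  show ?thesis
    using cube_moment_list[of "[i, j, k]"] cube_moment_1 assms
    by (cases "i = j"; cases "j = k"; cases "i = k") (auto simp: * ** mult.assoc)
qed

text \<open>Repeated signs cancel in pairs, leaving a monomial of degree 0, 2 or 4. Since
  \<open>k \<noteq> l\<close>, degree 0 occurs only when the pairs {i, j} and {k, l}
  coincide.\<close>

lemma cube_moment_4:
  assumes "i \<in> I" "j \<in> I" "k \<in> I" "l \<in> I" "k \<noteq> l"
  shows "(\<Sum>S\<in>even_subsets I. cube_sign S i * cube_sign S j * (cube_sign S k * cube_sign S l)) =
    real (card (even_subsets I)) * (of_bool (i = k \<and> j = l) + of_bool (i = l \<and> j = k))"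
proof -
  have m2: "(\<Sum>S\<in>even_subsets I. cube_sign S p * cube_sign S q) = 0"
    if "p \<in> I" "q \<in> I" "p \<noteq> q" for p q
    using cube_moment_2[of p q] that by simp
  have sq: "cube_sign S p * (cube_sign S p * x) = x" for S :: "'a set" and p x
    by (simp flip: mult.assoc)
  have sq': "cube_sign S p * (cube_sign S q * cube_sign S p) = cube_sign S q" for S :: "'a set" and p q
    by (simp add: cube_sign_def)
  consider "i = j" | "i \<noteq> j" "i = k" "j = l" | "i \<noteq> j" "i = l" "j = k"
    | "i \<noteq> j" "i = k" "j \<noteq> l" | "i \<noteq> j" "i = l" "j \<noteq> k"
    | "i \<noteq> j" "i \<noteq> k" "i \<noteq> l" "j = k" | "i \<noteq> j" "i \<noteq> k" "i \<noteq> l" "j = l"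
    | "i \<noteq> j" "i \<noteq> k" "i \<noteq> l" "j \<noteq> k" "j \<noteq> l" by blast
  then show ?thesis
  proof cases
    case 8
    then show ?thesis using cube_moment_list[of "[i, j, k, l]"] assms by (auto simp: mult.assoc)
  next
    case 4
    have e: "cube_sign S k * cube_sign S j * (cube_sign S k * cube_sign S l)
      = cube_sign S j * cube_sign S l" for S :: "'a set" by (simp add: cube_sign_def)
    then show ?thesis using 4 assms m2[of j l] by (simp add: e)
  next
    case 5
    have e: "cube_sign S l * cube_sign S j * (cube_sign S k * cube_sign S l)
      = cube_sign S j * cube_sign S k" for S :: "'a set" by (simp add: cube_sign_def)
    then show ?thesis using 5 assms m2[of j k] by (simp add: e)
  qed (use assms m2 in \<open>auto simp: mult.assoc sq sq'\<close>)
qed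

text \<open>Used to condense the inequalities at all half-cube vertices into one scalar
  inequality.\<close>

lemma sum_even_cube_quadratic:
  "(\<Sum>S\<in>even_subsets I. C + (\<Sum>i\<in>I. g i * cube_sign S i) +
      (\<Sum>i\<in>I. \<Sum>j\<in>I. K i j * (cube_sign S i * cube_sign S j))) =
    real (card (even_subsets I)) * (C + (\<Sum>i\<in>I. K i i))"
proof -
  have "(\<Sum>S\<in>even_subsets I. \<Sum>i\<in>I. g i * cube_sign S i) = 0"
    by (subst sum.swap) (simp add: cube_moment_1 flip: sum_distrib_left)
  moreover have "(\<Sum>S\<in>even_subsets I. \<Sum>i\<in>I. \<Sum>j\<in>I. K i j * (cube_sign S i * cube_sign S j)) =
      (\<Sum>i\<in>I. \<Sum>j\<in>I. K i j * (\<Sum>S\<in>even_subsets I. cube_sign S i * cube_sign S j))"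
    by (simp add: sum.swap[of _ "even_subsets I"] sum_distrib_left)
  moreover have "\<dots> = real (card (even_subsets I)) * (\<Sum>i\<in>I. K i i)"
    using fin by (simp add: cube_moment_2 sum_distrib_left if_distrib[of "\<lambda>x. _ * x"] of_bool_def
        sum.delta mult.commute cong: if_cong)
  ultimately show ?thesis by (simp add: sum.distrib algebra_simps)
qed

text \<open>Testing the polynomial against one sign, or against a product of two, isolates a
  coefficient by orthogonality. Only the symmetric part of \<open>K\<close> is visible, hence the
  sum of the two entries; the diagonal merges with the constant.\<close>

lemma even_cube_quadratic_eq_0:
  assumes zero: "\<And>S. S \<in> even_subsets I \<Longrightarrow>
    C + (\<Sum>i\<in>I. g i * cube_sign S i) + (\<Sum>i\<in>I. \<Sum>j\<in>I. K i j * (cube_sign S i * cube_sign S j)) = 0"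
  shows "k \<in> I \<Longrightarrow> g k = 0" "k \<in> I \<Longrightarrow> l \<in> I \<Longrightarrow> k \<noteq> l \<Longrightarrow> K k l + K l k = 0"
proof -
  let ?E = "even_subsets I"
  have N: "real (card ?E) > 0" using card_even_subsets_pos[OF fin] by simp
  \<comment> \<open>Here \<open>f\<close> is the test monomial against which the vanishing
    polynomial is summed.\<close>
  have moment: "C * (\<Sum>S\<in>?E. f S) + (\<Sum>i\<in>I. g i * (\<Sum>S\<in>?E. cube_sign S i * f S)) +
     (\<Sum>i\<in>I. \<Sum>j\<in>I. K i j * (\<Sum>S\<in>?E. cube_sign S i * cube_sign S j * f S)) = 0" for f
  proof -
    have "0 = (\<Sum>S\<in>?E. (C + (\<Sum>i\<in>I. g i * cube_sign S i) +
        (\<Sum>i\<in>I. \<Sum>j\<in>I. K i j * (cube_sign S i * cube_sign S j))) * f S)"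
      by (rule sum.neutral[symmetric]) (simp add: zero)
    also have "\<dots> = (\<Sum>S\<in>?E. C * f S) + (\<Sum>S\<in>?E. \<Sum>i\<in>I. g i * (cube_sign S i * f S)) +
        (\<Sum>S\<in>?E. \<Sum>i\<in>I. \<Sum>j\<in>I. K i j * (cube_sign S i * cube_sign S j * f S))"
      by (simp only: distrib_right sum.distrib sum_distrib_right mult.assoc)
    finally show ?thesis by (simp add: sum.swap[of _ ?E] sum_distrib_left)
  qed
  show "g k = 0" if "k \<in> I"
  proof -
    have "(\<Sum>i\<in>I. g i * (real (card ?E) * of_bool (i = k))) = 0"
      using moment[of "\<lambda>S. cube_sign S k"] that
      by (simp add: cube_moment_1 cube_moment_2 cube_moment_3)
    then show ?thesis using N that fin by (simp add: of_bool_def if_distrib[of "\<lambda>x. _ * x"] cong: if_cong)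
  qed
  show "K k l + K l k = 0" if kl: "k \<in> I" "l \<in> I" "k \<noteq> l"
  proof -
    have m3: "(\<Sum>S\<in>?E. cube_sign S i * (cube_sign S k * cube_sign S l)) = 0" if "i \<in> I" for i
      using cube_moment_3[OF that kl(1,2)] by (simp add: mult.assoc)
    have "(\<Sum>i\<in>I. \<Sum>j\<in>I. K i j * (real (card ?E) * (of_bool (i = k \<and> j = l) + of_bool (i = l \<and> j = k)))) = 0"
      using moment[of "\<lambda>S. cube_sign S k * cube_sign S l"] kl
      by (simp add: cube_moment_2 cube_moment_4 m3)
    also have "(\<Sum>i\<in>I. \<Sum>j\<in>I. K i j * (real (card ?E) * (of_bool (i = k \<and> j = l) + of_bool (i = l \<and> j = k)))) =
        real (card ?E) * (\<Sum>i\<in>I. \<Sum>j\<in>I. K i j * of_bool (i = k) * of_bool (j = l) + K i j * of_bool (i = l) * of_bool (j = k))"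
      by (simp add: sum_distrib_left algebra_simps of_bool_conj)
    also have "\<dots> = real (card ?E) * (K k l + K l k)"
      using kl fin by (simp add: sum.distrib of_bool_def if_distrib[of "\<lambda>x. _ * x"] cong: if_cong)
    finally show ?thesis using N by simp
  qed
qed

end

section \<open>The lattice and its deep holes\<close>

text \<open>Think of \<open>u i\<close> as the distance of coordinate i to the integers and of
  \<open>t\<close> as the height. The two brackets in \<open>ge\<close> bound the squared distances
  to layers 0 and 1; the terms \<open>1 - 2 * u j\<close> and \<open>2 * u i\<close> pay for a
  possible parity repair. The conclusion identifies the two equality cases, one for each deep hole
  in the slab.\<close>

lemma hole_inequality:
  fixes u :: "'a \<Rightarrow> real"
  assumes fin: "finite I" and card_I: "m = real (card I)" and ne: "I \<noteq> {}"
    and u: "\<And>i. i \<in> I \<Longrightarrow> 0 \<le> u i \<and> u i \<le> 1/2"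
    and t: "0 \<le> t" "t \<le> 1" and "a > 0"
    and s: "2 * a * s = 1 - m / 4 + a" and R: "R = m / 4 + a * s\<^sup>2"
    and ge: "\<And>i j. i \<in> I \<Longrightarrow> j \<in> I \<Longrightarrow>
      R \<le> (1 - t) * ((\<Sum>k\<in>I. (u k)\<^sup>2) + (1 - 2 * u j) + a * t\<^sup>2) +
        t * ((\<Sum>k\<in>I. (1/2 - u k)\<^sup>2) + 2 * u i + a * (1 - t)\<^sup>2)"
  shows "(\<forall>i\<in>I. u i = 1/2) \<and> t = s \<or> (\<forall>i\<in>I. u i = 0) \<and> t = 1 - s"
proof -
  \<comment> \<open>The repair is cheapest in layer 0 at a coordinate with the largest
    \<open>u\<close>, and in layer 1 at one with the smallest.\<close>
  define M \<mu> where "M = Max (u ` I)" and "\<mu> = Min (u ` I)"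
  have "M \<in> u ` I" "\<mu> \<in> u ` I" unfolding M_def \<mu>_def using fin ne by auto
  then obtain j i where j: "j \<in> I" "u j = M" and i: "i \<in> I" "u i = \<mu>" by auto
  have bounds: "\<mu> \<le> u k" "u k \<le> M" if "k \<in> I" for k
    using that fin by (auto simp: M_def \<mu>_def)
  have le: "\<mu> \<le> M" "0 \<le> \<mu>" "M \<le> 1/2" using bounds[OF i(1)] i j u by auto
  have m: "m \<ge> 1" using ne fin by (simp add: card_I Suc_leI card_gt_0_iff)
  (* w is convex, so every w k is at most its value at M or at \<mu>; this reduces the bound to the
     case of equal u k, where it becomes the quadratic \<phi>. *)
  define w where "w k = (u k)\<^sup>2 - t * u k" for k
  define rest where "rest = (1 - t) * (1 - 2 * M) + t * m / 4 + 2 * t * \<mu> + a * t * (1 - t)"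
  have T: "R \<le> (\<Sum>k\<in>I. w k) + rest"
  proof -
    have "(\<Sum>k\<in>I. (1/2 - u k)\<^sup>2) = (\<Sum>k\<in>I. 1/4 + ((u k)\<^sup>2 - u k))"
      by (intro sum.cong) (auto simp: power2_eq_square algebra_simps)
    also have "\<dots> = m / 4 + ((\<Sum>k\<in>I. (u k)\<^sup>2) - (\<Sum>k\<in>I. u k))"
      by (simp add: sum.distrib sum_subtractf card_I)
    finally show ?thesis using ge[OF i(1) j(1)]
      by (simp add: i j w_def rest_def sum_subtractf sum_distrib_left[symmetric] algebra_simps power2_eq_square)
  qed
  define \<phi> where "\<phi> x = m * (x\<^sup>2 - t * x) + 2 * t * x + (1 - t) * (1 - 2 * x) + t * m / 4 + a * t * (1 - t)" for x
  \<comment> \<open>For x in [0, 1/2] this writes \<open>R - \<phi> x\<close> as a sum of three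
    nonnegative deficits. They vanish together only for x = 1/2, t = s or for x = 0, t = 1 -
    s.\<close>
  have phi: "\<phi> x = R - (1 - 2 * x) * (a * (t - (1 - s))\<^sup>2) - 2 * x * (a * (t - s)\<^sup>2) - m * (x * (1/2 - x))" for x
  proof -
    have m: "m = 4 + 4 * a - 8 * a * s" using s by (simp add: field_simps)
    show ?thesis unfolding \<phi>_def R m by algebra
  qed
  \<comment> \<open>The number \<open>d\<close> is the slack lost by replacing all the
    \<open>u k\<close> with the common value \<open>x\<close>.\<close>
  have step: "(\<forall>k\<in>I. u k = 1/2) \<and> t = s \<or> (\<forall>k\<in>I. u k = 0) \<and> t = 1 - s"
    if x: "0 \<le> x" "x \<le> 1/2" and d: "0 \<le> d" "R \<le> \<phi> x - d"
      and d0: "d = 0 \<Longrightarrow> x = 0 \<or> x = 1/2 \<Longrightarrow> \<forall>k\<in>I. u k = x" for x d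
  proof -
    have nn: "0 \<le> (1 - 2 * x) * (a * (t - (1 - s))\<^sup>2)" "0 \<le> 2 * x * (a * (t - s)\<^sup>2)"
      "0 \<le> m * (x * (1/2 - x))" using x m \<open>a > 0\<close> by (simp_all add: mult_nonneg_nonneg)
    have "R \<le> R - (1 - 2 * x) * (a * (t - (1 - s))\<^sup>2) - 2 * x * (a * (t - s)\<^sup>2) - m * (x * (1/2 - x)) - d"
      using d(2) by (simp only: phi)
    then have z: "(1 - 2 * x) * (a * (t - (1 - s))\<^sup>2) = 0" "2 * x * (a * (t - s)\<^sup>2) = 0"
      "m * (x * (1/2 - x)) = 0" "d = 0" using nn d(1) by linarith+
    from z(3) m consider "x = 0" | "x = 1/2" by auto
    then show ?thesis
      using z(1,2) d0[OF z(4)] \<open>a > 0\<close> by cases auto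
  qed
  show ?thesis
  \<comment> \<open>By convexity \<open>w\<close> is largest at an end of [\<mu>, M], and comparing
    \<open>M\<^sup>2 - t * M\<close> with \<open>\<mu>\<^sup>2 - t * \<mu>\<close> shows that
    \<open>M\<close> wins exactly when \<open>t \<le> M + \<mu>\<close>, apart from ties.\<close>
  proof (cases "t \<le> M + \<mu>")
    case True
    have "w k \<le> M\<^sup>2 - t * M" if "k \<in> I" for k
    proof -
      have "0 \<le> (M - u k) * (M + u k - t)"
        using bounds[OF that] True by (intro mult_nonneg_nonneg) linarith+
      then show ?thesis by (simp add: w_def power2_eq_square algebra_simps)
    qed
    \<comment> \<open>Keeping the term at the minimum separate gives the slack
      \<open>(M - \<mu>) * (M + \<mu> + t)\<close>, which forces \<open>M = \<mu>\<close> when it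
      vanishes. Replacing that term as well would leave only \<open>2 * t * (M - \<mu>)\<close>,
      which is uninformative at t = 0.\<close>
    then have "(\<Sum>k\<in>I - {i}. w k) \<le> real (card (I - {i})) * (M\<^sup>2 - t * M)"
      by (intro sum_bounded_above) auto
    then have "(\<Sum>k\<in>I - {i}. w k) \<le> (m - 1) * (M\<^sup>2 - t * M)"
      using m fin i(1) by (simp add: card_I of_nat_diff)
    then have "(\<Sum>k\<in>I. w k) \<le> \<mu>\<^sup>2 - t * \<mu> + (m - 1) * (M\<^sup>2 - t * M)"
      using sum.remove[OF fin i(1), of w] by (simp add: w_def i)
    with T have "R \<le> \<phi> M - (M - \<mu>) * (M + \<mu> + t)"
      by (simp add: rest_def \<phi>_def power2_eq_square algebra_simps)
    moreover have "\<forall>k\<in>I. u k = M" if "(M - \<mu>) * (M + \<mu> + t) = 0"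
    proof -
      have "M = \<mu>" using that le t unfolding mult_eq_0_iff by (elim disjE) linarith+
      then show ?thesis using bounds by force
    qed
    ultimately show ?thesis using le t by (intro step[of M "(M - \<mu>) * (M + \<mu> + t)"]) auto
  next
    case False
    have "w k \<le> \<mu>\<^sup>2 - t * \<mu>" if "k \<in> I" for k
    proof -
      have "0 \<le> (u k - \<mu>) * (t - u k - \<mu>)"
        using bounds[OF that] False by (intro mult_nonneg_nonneg) linarith+
      then show ?thesis by (simp add: w_def power2_eq_square algebra_simps)
    qed
    then have "(\<Sum>k\<in>I - {j}. w k) \<le> real (card (I - {j})) * (\<mu>\<^sup>2 - t * \<mu>)"
      by (intro sum_bounded_above) auto
    then have "(\<Sum>k\<in>I - {j}. w k) \<le> (m - 1) * (\<mu>\<^sup>2 - t * \<mu>)"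
      using m fin j(1) by (simp add: card_I of_nat_diff)
    then have "(\<Sum>k\<in>I. w k) \<le> M\<^sup>2 - t * M + (m - 1) * (\<mu>\<^sup>2 - t * \<mu>)"
      using sum.remove[OF fin j(1), of w] by (simp add: w_def j)
    with T have "R \<le> \<phi> \<mu> - (M - \<mu>) * (2 - t - M - \<mu>)"
      by (simp add: rest_def \<phi>_def power2_eq_square algebra_simps)
    moreover have "\<forall>k\<in>I. u k = \<mu>" if "(M - \<mu>) * (2 - t - M - \<mu>) = 0"
    proof -
      have "M = \<mu>" using that le t unfolding mult_eq_0_iff by (elim disjE) linarith+
      then show ?thesis using bounds by force
    qed
    ultimately show ?thesis using le t by (intro step[of \<mu> "(M - \<mu>) * (2 - t - M - \<mu>)"]) auto
  qed
qed

section \<open>The candidate hole, its height and its radius\<close>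

locale index_enumeration =
  fixes e :: "nat \<Rightarrow> 'n::finite" and n :: nat
  assumes card_n: "CARD('n) = n" and n_ge_6: "6 \<le> n" and bij: "bij_betw e {1..n} UNIV"
begin

abbreviation "last_ix \<equiv> e n"
abbreviation "I \<equiv> UNIV - {last_ix}"
abbreviation "a \<equiv> last_coeff n"
abbreviation "m \<equiv> real (n - 1)"

text \<open>The hole sits at height \<open>- hole_height\<close>, strictly above layer -1 and at or
  below layer 0. For even n the value is 1 / (n - 3); for odd n the hole lies in layer 0
  itself.\<close>

definition "hole_height = (if even n then 1 / (4 * a) else 0)"
definition "hole_radius2 = m / 4 + a * hole_height\<^sup>2"
definition "deep_hole = (\<chi> i. if i = last_ix then - hole_height else - (1/2))"

lemma bij_I: "bij_betw e {1..n - 1} I"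
proof -
  have "bij_betw e ({1..n} - {n}) (UNIV - {last_ix})"
    using bij by (intro bij_betw_DiffI) (auto simp: bij_betw_def)
  moreover have "{1..n} - {n} = {1..n - 1}" using n_ge_6 by auto
  ultimately show ?thesis by simp
qed

lemma card_I: "card I = n - 1"
  using bij_betw_same_card[OF bij_I] by simp

lemma sum_I: "(\<Sum>i = 1..n - 1. f (e i)) = (\<Sum>i\<in>I. f i)"
  using sum.reindex_bij_betw[OF bij_I] .

lemma first_in_I: "e 1 \<in> I"
  using bij_betwE[OF bij_I] n_ge_6 by (auto simp: Ball_def)

lemma split_last: "(\<Sum>i\<in>UNIV. f i) = f last_ix + (\<Sum>i\<in>I. f i)"
  by (subst sum.remove[of UNIV last_ix]) auto

lemma a_ge: "1 / 2 \<le> a"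
  using n_ge_6 by (auto simp: last_coeff_def elim!: oddE)

lemma hole_height_bounds: "0 \<le> hole_height" "hole_height \<le> 1 / 3"
proof -
  have "3 / 4 \<le> a" if "even n" using that n_ge_6 by (auto simp: last_coeff_def)
  then show "0 \<le> hole_height" "hole_height \<le> 1 / 3"
    using a_ge by (auto simp: hole_height_def field_simps)
qed

lemma m_eq: "m = real n - 1"
  using n_ge_6 by (simp add: of_nat_diff)

text \<open>This is the equidistance condition
  \<open>m / 4 + a * s\<^sup>2 = 1 + a * (1 - s)\<^sup>2\<close> with the squares of s cancelled:
  half-cube points of one layer and cross-polytope points of the next are equally far from the
  hole.\<close>

lemma hole_height_eq: "2 * a * hole_height = 1 - m / 4 + a"
  using a_ge n_ge_6 by (auto simp: hole_height_def last_coeff_def m_eq field_simps)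

lemma hole_radius2_eq: "hole_radius2 = 1 + a * (1 - hole_height)\<^sup>2"
  using hole_height_eq by (simp add: hole_radius2_def power2_eq_square algebra_simps)

lemma hole_radius2_pos: "hole_radius2 > 0"
  using a_ge by (simp add: hole_radius2_eq add_pos_nonneg)

lemma qform_Q: "qform (Q_mat e) x = (\<Sum>i\<in>I. (x $ i)\<^sup>2) + a * (x $ last_ix)\<^sup>2"
  using qform_Q_mat[of e x, unfolded card_n, OF bij] unfolding sum_I[of "\<lambda>i. (x $ i)\<^sup>2"] .

section \<open>Integer coordinates and a basis of the lattice\<close>

lemma mem_D_root_lattice:
  "x \<in> D_root_lattice e \<longleftrightarrow>
    (\<forall>i\<in>I. x $ i \<in> \<int>) \<and> (\<exists>k\<in>\<int>. (\<Sum>i\<in>I. x $ i) = 2 * k) \<and> x $ last_ix = 0"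
proof -
  have "(\<forall>i\<in>I. x $ i \<in> \<int>) \<longleftrightarrow> (\<forall>i\<in>{1..n - 1}. x $ e i \<in> \<int>)"
    unfolding bij_betw_imp_surj_on[OF bij_I, symmetric] by (rule ball_simps)
  then show ?thesis
    unfolding D_root_lattice_def mem_Collect_eq card_n sum_I[of "\<lambda>i. x $ i"] by blast
qed

text \<open>Passing to an integer-valued coordinate function makes the parity condition available as
  \<open>even\<close>.\<close>

lemma D_root_lattice_iff:
  "x \<in> D_root_lattice e \<longleftrightarrow>
    (\<exists>y :: 'n \<Rightarrow> int. even (\<Sum>i\<in>I. y i) \<and> (\<forall>i\<in>I. x $ i = of_int (y i)) \<and> x $ last_ix = 0)"
  (is "?L \<longleftrightarrow> ?R")
proof
  assume ?L
  then have x: "\<forall>i\<in>I. x $ i \<in> \<int>" "x $ last_ix = 0" and ex: "\<exists>k\<in>\<int>. (\<Sum>i\<in>I. x $ i) = 2 * k"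
    unfolding mem_D_root_lattice by auto
  define y where "y i = \<lfloor>x $ i\<rfloor>" for i
  have y: "\<forall>i\<in>I. x $ i = of_int (y i)" using x by (simp add: y_def)
  obtain r where "(\<Sum>i\<in>I. x $ i) = 2 * of_int r" using ex by (auto elim!: Ints_cases)
  then have "real_of_int (\<Sum>i\<in>I. y i) = of_int (2 * r)" using y by simp
  then have "(\<Sum>i\<in>I. y i) = 2 * r" by (simp only: of_int_eq_iff)
  then show ?R using x y by (intro exI[of _ y]) simp
next
  assume ?R
  then obtain y where y: "even (\<Sum>i\<in>I. y i)" "\<forall>i\<in>I. x $ i = of_int (y i)" "x $ last_ix = 0"
    by blast
  then obtain r where "(\<Sum>i\<in>I. y i) = 2 * r" by blast
  then have "(\<Sum>i\<in>I. x $ i) = 2 * of_int r" using y(2) by (simp flip: of_int_sum)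
  then show ?L unfolding mem_D_root_lattice using y by auto
qed

lemma D_root_lattice_subspace: "int_module.subspace (D_root_lattice e)"
proof (rule int_module.subspaceI)
  show "0 \<in> D_root_lattice e" unfolding D_root_lattice_iff by (intro exI[of _ "\<lambda>_. 0"]) simp
  show "x + y \<in> D_root_lattice e" if xy: "x \<in> D_root_lattice e" "y \<in> D_root_lattice e" for x y
  proof -
    from xy obtain p q where "even (\<Sum>i\<in>I. p i)" "\<forall>i\<in>I. x $ i = of_int (p i)" "x $ last_ix = 0"
      "even (\<Sum>i\<in>I. q i)" "\<forall>i\<in>I. y $ i = of_int (q i)" "y $ last_ix = 0"
      unfolding D_root_lattice_iff by blast
    then show ?thesis unfolding D_root_lattice_iff
      by (intro exI[of _ "\<lambda>i. p i + q i"]) (simp add: sum.distrib)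
  qed
  show "of_int c *\<^sub>R x \<in> D_root_lattice e" if x: "x \<in> D_root_lattice e" for c x
  proof -
    from x obtain p where "even (\<Sum>i\<in>I. p i)" "\<forall>i\<in>I. x $ i = of_int (p i)" "x $ last_ix = 0"
      unfolding D_root_lattice_iff by blast
    then show ?thesis unfolding D_root_lattice_iff
      by (intro exI[of _ "\<lambda>i. c * p i"]) (simp flip: sum_distrib_left)
  qed
qed

lemma glue_nth: "i \<in> I \<Longrightarrow> glue_vec e $ i = 1/2 - of_bool (i = e 1)" "glue_vec e $ last_ix = 1"
  using first_in_I by (auto simp: glue_vec_def card_n)

text \<open>
  Subtracting the integer vector of the first coordinate from the glue vector makes its layer
  description symmetric in the first \<open>n - 1\<close> coordinates, at the cost of a parity condition.
\<close>

lemma L_lattice_iff: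
  "x \<in> L_lattice e \<longleftrightarrow>
    (\<exists>(k :: int) (y :: 'n \<Rightarrow> int). even ((\<Sum>i\<in>I. y i) + k) \<and>
       (\<forall>i\<in>I. x $ i = of_int (y i) + of_int k / 2) \<and> x $ last_ix = of_int k)"
proof -
  have span_D: "int_span (D_root_lattice e) = D_root_lattice e"
    using D_root_lattice_subspace by (rule int_module.span_eq_iff[THEN iffD2])
  have shift: "(\<Sum>i\<in>I. y i + c * of_bool (i = e 1)) = (\<Sum>i\<in>I. y i) + c" for y and c :: int
    using first_in_I by (simp add: sum.distrib of_bool_def if_distrib[of "\<lambda>x. _ * x"] cong: if_cong)
  have "x \<in> L_lattice e \<longleftrightarrow> (\<exists>k. x - of_int k *\<^sub>R glue_vec e \<in> D_root_lattice e)"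
    unfolding L_lattice_def int_module.span_insert span_D by simp
  also have "\<dots> \<longleftrightarrow> (\<exists>(k :: int) (y :: 'n \<Rightarrow> int). even ((\<Sum>i\<in>I. y i) + k) \<and>
       (\<forall>i\<in>I. x $ i = of_int (y i) + of_int k / 2) \<and> x $ last_ix = of_int k)"
  proof (intro iff_exI iffI)
    fix k assume "x - of_int k *\<^sub>R glue_vec e \<in> D_root_lattice e"
    then obtain y where y: "even (\<Sum>i\<in>I. y i)"
      "\<forall>i\<in>I. x $ i - of_int k * glue_vec e $ i = of_int (y i)" "x $ last_ix = of_int k"
      unfolding D_root_lattice_iff by (auto simp: glue_nth(2))
    show "\<exists>y. even ((\<Sum>i\<in>I. y i) + k) \<and>
       (\<forall>i\<in>I. x $ i = of_int (y i) + of_int k / 2) \<and> x $ last_ix = of_int k"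
    proof (intro exI[of _ "\<lambda>i. y i + (- k) * of_bool (i = e 1)"] conjI ballI)
      show "even ((\<Sum>i\<in>I. y i + (- k) * of_bool (i = e 1)) + k)"
        unfolding shift using y(1) by simp
      show "x $ i = of_int (y i + (- k) * of_bool (i = e 1)) + of_int k / 2" if "i \<in> I" for i
        using bspec[OF y(2) that] by (simp add: glue_nth(1)[OF that] algebra_simps)
    qed (fact y(3))
  next
    fix k assume "\<exists>y. even ((\<Sum>i\<in>I. y i) + k) \<and>
       (\<forall>i\<in>I. x $ i = of_int (y i) + of_int k / 2) \<and> x $ last_ix = of_int k"
    then obtain y where y: "even ((\<Sum>i\<in>I. y i) + k)"
      "\<forall>i\<in>I. x $ i = of_int (y i) + of_int k / 2" "x $ last_ix = of_int k" by blast
    show "x - of_int k *\<^sub>R glue_vec e \<in> D_root_lattice e"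
      unfolding D_root_lattice_iff
    proof (intro exI[of _ "\<lambda>i. y i + k * of_bool (i = e 1)"] conjI ballI)
      show "even (\<Sum>i\<in>I. y i + k * of_bool (i = e 1))"
        unfolding shift by (fact y(1))
      show "(x - of_int k *\<^sub>R glue_vec e) $ i = of_int (y i + k * of_bool (i = e 1))" if "i \<in> I" for i
        using bspec[OF y(2) that] by (simp add: glue_nth(1)[OF that] algebra_simps)
    qed (simp add: y(3) glue_nth(2))
  qed
  finally show ?thesis .
qed

lemma L_latticeI:
  assumes "even ((\<Sum>i\<in>I. y i) + k)" "\<And>i. i \<in> I \<Longrightarrow> x $ i = of_int (y i) + of_int k / 2"
    "x $ last_ix = of_int k"
  shows "x \<in> L_lattice e"
  using assms unfolding L_lattice_iff by blast

lemma L_lattice_add: "u \<in> L_lattice e \<Longrightarrow> v \<in> L_lattice e \<Longrightarrow> u + v \<in> L_lattice e"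
  unfolding L_lattice_def by (rule int_module.span_add)

text \<open>Solve the parity condition: the height k, the integers y away from the first coordinate,
  and half of the even number \<open>(\<Sum>i\<in>I. y i) + k\<close> are free and determine y at
  the first coordinate.\<close>

lemma lattice_basis_exists: "\<exists>B. lattice_basis B (L_lattice e)"
proof -
  define o' where "o' = e 1"
  \<comment> \<open>The entry of z at \<open>o'\<close> is the half-sum r. The sum over
    \<open>UNIV - {o'}\<close> includes the last entry k, so the integer part at \<open>o'\<close>
    is 2 r - k minus the other y.\<close>
  define f :: "real^'n \<Rightarrow> real^'n" where "f z = (\<chi> i.
     if i = last_ix then z $ i
     else if i = o' then 2 * z $ o' - (\<Sum>j\<in>UNIV - {o'}. z $ j) + z $ last_ix / 2
     else z $ i + z $ last_ix / 2)" for z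
  have o_in: "o' \<in> I" using first_in_I by (simp add: o'_def)
  then have o: "o' \<noteq> last_ix" by simp
  have lin: "linear f"
    by (rule linearI) (auto simp: vec_eq_iff f_def sum.distrib sum_distrib_left[symmetric] algebra_simps add_divide_distrib)
  have z0: "z = 0" if "f z = 0" for z
  proof -
    have f0: "f z $ i = 0" for i using that by simp
    have l: "z $ last_ix = 0" using f0[of last_ix] by (simp add: f_def)
    have j: "z $ i = 0" if "i \<noteq> o'" for i
      using f0[of i] l that by (cases "i = last_ix") (auto simp: f_def)
    have "z $ o' = 0" using f0[of o'] j l o by (simp add: f_def)
    then show ?thesis using j by (metis vec_eq_iff zero_index)
  qed
  define B where "B = matrix f"
  have Bf: "B *v z = f z" for z using lin by (simp add: B_def matrix_works)
  have "invertible B"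
    unfolding invertible_left_inverse matrix_left_invertible_ker using z0 by (simp add: Bf)
  moreover have "L_lattice e = (\<lambda>z. B *v z) ` int_vecs"
  proof (intro equalityI subsetI)
    fix x assume "x \<in> L_lattice e"
    then obtain k y where x: "even ((\<Sum>i\<in>I. y i) + k)"
       "\<forall>i\<in>I. x $ i = of_int (y i) + of_int k / 2" "x $ last_ix = of_int k"
      unfolding L_lattice_iff by blast
    obtain r where r: "(\<Sum>i\<in>I. y i) + k = 2 * r" using x(1) by blast
    define z :: "real^'n" where "z = (\<chi> i. of_int (if i = last_ix then k else if i = o' then r else y i))"
    have "(\<Sum>j\<in>UNIV - {o'}. z $ j) = z $ last_ix + (\<Sum>j\<in>I - {o'}. z $ j)"
      using o by (subst sum.remove[of _ last_ix]) (auto intro!: sum.cong)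
    also have "(\<Sum>j\<in>I - {o'}. z $ j) = of_int (\<Sum>j\<in>I - {o'}. y j)"
      by (simp add: z_def)
    also have "(\<Sum>j\<in>I - {o'}. y j) = 2 * r - k - y o'"
      using sum.remove[of I o' y] o_in r by simp
    finally have s: "(\<Sum>j\<in>UNIV - {o'}. z $ j) = 2 * of_int r - of_int (y o')"
      using o by (simp add: z_def)
    have "x = f z"
      using x(2,3) o o_in by (auto simp: vec_eq_iff f_def s) (auto simp: z_def)
    moreover have "z \<in> int_vecs" by (simp add: int_vecs_def z_def)
    ultimately show "x \<in> (\<lambda>z. B *v z) ` int_vecs" by (auto simp: Bf)
  next
    fix x assume "x \<in> (\<lambda>z. B *v z) ` int_vecs"
    then obtain z where z: "z \<in> int_vecs" "x = f z" by (auto simp: Bf)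
    define w where "w i = \<lfloor>z $ i\<rfloor>" for i
    have w: "z $ i = of_int (w i)" for i using z(1) by (simp add: w_def int_vecs_def)
    define y where "y i = (if i = o' then 2 * w o' - (\<Sum>j\<in>UNIV - {o'}. w j) else w i)" for i
    have "(\<Sum>j\<in>UNIV - {o'}. w j) = w last_ix + (\<Sum>j\<in>I - {o'}. w j)"
      using o by (subst sum.remove[of _ last_ix]) (auto intro!: sum.cong)
    moreover have "(\<Sum>i\<in>I. y i) = y o' + (\<Sum>j\<in>I - {o'}. w j)"
      using sum.remove[of I o' y] o_in by (simp add: y_def)
    ultimately have "(\<Sum>i\<in>I. y i) + w last_ix = 2 * w o'"
      by (simp add: y_def)
    then show "x \<in> L_lattice e"
      using o by (intro L_latticeI[of y "w last_ix"]) (auto simp: z(2) f_def y_def w)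
  qed
  ultimately show ?thesis unfolding lattice_basis_def by blast
qed

section \<open>Emptiness of the sphere around the hole\<close>

lemma m_ge_5: "5 \<le> m"
  using n_ge_6 by simp

text \<open>Relative to the hole, the first coordinates are half odd integers in even layers,
  contributing at least m / 4. In odd layers they are integers: either one is nonzero and
  contributes at least 1, or all vanish and parity pushes the layer far enough away.\<close>

lemma deep_hole_empty_sphere:
  assumes "v \<in> L_lattice e"
  shows "hole_radius2 \<le> qform (Q_mat e) (v - deep_hole)"
proof -
  obtain k y where y: "even ((\<Sum>i\<in>I. y i) + k)"
    "\<And>i. i \<in> I \<Longrightarrow> v $ i = of_int (y i) + of_int k / 2" "v $ last_ix = of_int k"
    using assms unfolding L_lattice_iff by blast
  define s where "s = hole_height"
  have s: "0 \<le> s" "s \<le> 1/3" using hole_height_bounds by (auto simp: s_def)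
  have a: "a > 0" using a_ge by linarith
  have q: "qform (Q_mat e) (v - deep_hole) =
      (\<Sum>i\<in>I. (of_int (y i) + (of_int k + 1) / 2)\<^sup>2) + a * (of_int k + s)\<^sup>2"
    unfolding qform_Q by (simp add: y(2,3) deep_hole_def s_def add_divide_distrib algebra_simps)
  have sq: "a * x\<^sup>2 \<le> a * (of_int k + s)\<^sup>2" if "\<bar>x\<bar> \<le> \<bar>of_int k + s\<bar>" for x
    using a that by (intro mult_left_mono) (auto simp: abs_le_square_iff)
  show ?thesis
  proof (cases "even k")
    case True
    have "1 / 4 \<le> (real_of_int (y i) + (of_int k + 1) / 2)\<^sup>2" for i
    proof -
      obtain h where "k = 2 * h" using True by blast
      then have eq: "real_of_int (y i) + (of_int k + 1) / 2 = of_int (y i + h) + 1 / 2"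
        by (simp add: field_simps)
      \<comment> \<open>A product of two consecutive integers q (q + 1) is nonnegative, and (q +
        1/2)^2 = q (q + 1) + 1/4.\<close>
      have "0 \<le> real_of_int ((y i + h) * (y i + h + 1))"
        by (cases "0 \<le> y i + h") (auto simp: zero_le_mult_iff)
      then show ?thesis unfolding eq by (simp add: power2_eq_square algebra_simps)
    qed
    then have "(\<Sum>i\<in>I. 1 / 4) \<le> (\<Sum>i\<in>I. (real_of_int (y i) + (of_int k + 1) / 2)\<^sup>2)"
      by (intro sum_mono)
    then have "m / 4 \<le> (\<Sum>i\<in>I. (real_of_int (y i) + (of_int k + 1) / 2)\<^sup>2)"
      by (simp add: card_I)
    moreover have "\<bar>s\<bar> \<le> \<bar>of_int k + s\<bar>"
    proof -
      consider "k = 0" | "k \<ge> 1" | "k \<le> -1" by linarith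
      then show ?thesis using s by cases auto
    qed
    then have "a * s\<^sup>2 \<le> a * (of_int k + s)\<^sup>2" by (rule sq)
    ultimately show ?thesis unfolding q hole_radius2_def s_def by linarith
  next
    case False
    then have "even (k + 1)" by simp
    then obtain h where "k + 1 = 2 * h" by blast
    then have h: "k = 2 * h - 1" by simp
    then have eq: "real_of_int (y i) + (of_int k + 1) / 2 = of_int (y i + h)" for i
      by simp
    show ?thesis
    proof (cases "\<forall>i\<in>I. y i + h = 0")
      case True
      \<comment> \<open>As k is odd, the parity condition makes both n - 1 and h odd. Thus n is even
        and k = 2 h - 1 is congruent to 1 modulo 4, which excludes layer -1.\<close>
      then have "(\<Sum>i\<in>I. y i) = (\<Sum>i\<in>I. - h)"
        by (intro sum.cong) (auto simp: eq_neg_iff_add_eq_0)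
      then have "even (k - int (n - 1) * h)" using y(1) by (simp add: card_I)
      then have "odd (int (n - 1))" "odd h" using h by auto
      then have "even n" using n_ge_6 by (auto simp: of_nat_diff)
      then have b: "2 * a * s = 1 / 2" using a by (simp add: s_def hole_height_def)
      have "h \<ge> 1 \<or> h \<le> -1" using \<open>odd h\<close> by (cases "h = 0") auto
      then have "k \<ge> 1 \<or> k \<le> -3" using h by auto
      then have "\<bar>1 + s\<bar> \<le> \<bar>of_int k + s\<bar>" using s by auto
      then have "a * (1 + s)\<^sup>2 \<le> a * (of_int k + s)\<^sup>2" by (rule sq)
      \<comment> \<open>The radius as the distance to the apex straight above the hole; it agrees
        with the other expression because 4 a s = 1 for even n.\<close>
      moreover have "hole_radius2 = a * (1 + s)\<^sup>2"
        using b hole_radius2_eq by (simp add: s_def power2_eq_square algebra_simps)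
      ultimately show ?thesis
        unfolding q by (simp add: add_increasing sum_nonneg)
    next
      case False
      then obtain i where i: "i \<in> I" "y i + h \<noteq> 0" by blast
      have "1 \<le> (y i + h)\<^sup>2" using i(2) by (simp add: int_one_le_iff_zero_less)
      then have "1 \<le> real_of_int ((y i + h)\<^sup>2)" by linarith
      also have "\<dots> \<le> (\<Sum>i\<in>I. (real_of_int (y i) + (of_int k + 1) / 2)\<^sup>2)"
        unfolding eq using i(1) by (simp only: of_int_power) (rule member_le_sum, auto)
      finally have "1 \<le> (\<Sum>i\<in>I. (real_of_int (y i) + (of_int k + 1) / 2)\<^sup>2)" .
      moreover have "\<bar>1 - s\<bar> \<le> \<bar>of_int k + s\<bar>"
      proof -
        have "k \<ge> 1 \<or> k \<le> -1" using \<open>odd k\<close> by (cases "k = 0") auto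
        then show ?thesis using s by auto
      qed
      then have "a * (1 - s)\<^sup>2 \<le> a * (of_int k + s)\<^sup>2" by (rule sq)
      ultimately show ?thesis unfolding q hole_radius2_eq s_def by linarith
    qed
  qed
qed

section \<open>Points not strictly covered are deep holes\<close>

lemma parity_choice:
  fixes y :: "'n \<Rightarrow> int"
  assumes "j \<in> I" "\<bar>y' - y j\<bar> = 1"
  obtains w where "w = y \<or> w = y(j := y')" "even ((\<Sum>i\<in>I. w i) + p)"
proof (cases "even ((\<Sum>i\<in>I. y i) + p)")
  case False
  have "(\<Sum>i\<in>I. (y(j := y')) i) = y' + (\<Sum>i\<in>I - {j}. y i)"
    using assms(1) by (subst sum.remove[of _ j]) auto
  moreover have "(\<Sum>i\<in>I. y i) = y j + (\<Sum>i\<in>I - {j}. y i)"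
    using assms(1) by (subst sum.remove[of _ j]) auto
  moreover have "odd (y' - y j)" using assms(2) by (metis abs_1 dvd_abs_iff odd_one)
  ultimately have "even ((\<Sum>i\<in>I. (y(j := y')) i) + p)" using False by auto
  then show ?thesis using that by blast
qed (use that in blast)

text \<open>Charges the cost of the parity repair at j whether or not the repair was made. The map
  \<open>f\<close> sends an integer to the corresponding coordinate value in the layer, so both
  layers share one lemma.\<close>

lemma sum_fun_upd_square:
  fixes z :: "'n \<Rightarrow> real"
  assumes "j \<in> I" "w = y \<or> w = y(j := y')" "(z j - f (y j))\<^sup>2 \<le> (z j - f y')\<^sup>2"
  shows "(\<Sum>i\<in>I. (z i - f (w i))\<^sup>2) \<le> (\<Sum>i\<in>I. (z i - f (y i))\<^sup>2) - (z j - f (y j))\<^sup>2 + (z j - f y')\<^sup>2"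
proof -
  have "(\<Sum>i\<in>I. (z i - f (w i))\<^sup>2) = (z j - f (w j))\<^sup>2 + (\<Sum>i\<in>I - {j}. (z i - f (y i))\<^sup>2)"
    using assms(1,2) by (subst sum.remove[of _ j]) auto
  moreover have "(\<Sum>i\<in>I. (z i - f (y i))\<^sup>2) = (z j - f (y j))\<^sup>2 + (\<Sum>i\<in>I - {j}. (z i - f (y i))\<^sup>2)"
    using assms(1) by (subst sum.remove[of _ j]) auto
  ultimately show ?thesis using assms(2,3) by auto
qed

text \<open>If x has no close lattice point, its roundings to layers 0 and 1, repaired for parity,
  satisfy the hypothesis of \<open>hole_inequality\<close>. In either equality case the wrong parity
  would put a lattice point vertically above or below x within the radius, so x is a translate of
  the hole or of its negative.\<close>

lemma cover_slab:
  assumes t: "0 \<le> x $ last_ix" "x $ last_ix \<le> 1"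
  shows "(\<exists>v\<in>L_lattice e. qform (Q_mat e) (x - v) < hole_radius2) \<or>
    (\<exists>u\<in>L_lattice e. x = u + deep_hole \<or> x = u - deep_hole)"
proof (rule disj_imp[THEN iffD2], rule impI)
  assume far: "\<not> (\<exists>v\<in>L_lattice e. qform (Q_mat e) (x - v) < hole_radius2)"
  define t where "t = x $ last_ix"
  define s where "s = hole_height"
  define r where "r i = round (x $ i)" for i
  define u where "u i = \<bar>x $ i - of_int (r i)\<bar>" for i
  have u: "0 \<le> u i" "u i \<le> 1/2" for i
    using of_int_round_abs_le[of "x $ i"] by (auto simp: u_def r_def abs_minus_commute)
  have far': "hole_radius2 \<le> (\<Sum>i\<in>I. (x $ i - (of_int (y i) + of_int k / 2))\<^sup>2) + a * (t - of_int k)\<^sup>2"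
    if "even ((\<Sum>i\<in>I. y i) + k)" for y k
  proof -
    define v :: "real^'n" where "v = (\<chi> i. if i = last_ix then of_int k else of_int (y i) + of_int k / 2)"
    have "v \<in> L_lattice e" using that by (rule L_latticeI) (auto simp: v_def)
    with far have "hole_radius2 \<le> qform (Q_mat e) (x - v)" by (auto simp: not_less)
    then show ?thesis by (simp add: qform_Q v_def t_def)
  qed
  have "(\<forall>i\<in>I. u i = 1/2) \<and> t = s \<or> (\<forall>i\<in>I. u i = 0) \<and> t = 1 - s"
  proof (rule hole_inequality[where m = m and a = a and R = hole_radius2])
    show "2 * a * s = 1 - m / 4 + a" using hole_height_eq by (simp add: s_def)
    show "hole_radius2 = m / 4 + a * s\<^sup>2" by (simp add: hole_radius2_def s_def)
    show "0 \<le> t" "t \<le> 1" using t by (auto simp: t_def)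
    show "a > 0" using a_ge by linarith
    fix i j assume ij: "i \<in> I" "j \<in> I"
    have "hole_radius2 \<le> (\<Sum>k\<in>I. (u k)\<^sup>2) + (1 - 2 * u j) + a * t\<^sup>2"
    proof -
      \<comment> \<open>The second nearest integer, at distance \<open>1 - u j\<close>.\<close>
      define r' where "r' = (if x $ j \<ge> of_int (r j) then r j + 1 else r j - 1)"
      have uj: "(x $ j - of_int (r j))\<^sup>2 = (u j)\<^sup>2" by (simp add: u_def)
      have uj': "(x $ j - of_int r')\<^sup>2 = (1 - u j)\<^sup>2"
        by (auto simp: u_def r'_def power2_eq_square algebra_simps)
      obtain w where w: "w = r \<or> w = r(j := r')" "even ((\<Sum>i\<in>I. w i) + 0)"
        by (rule parity_choice[OF ij(2), of r' r 0]) (simp add: r'_def)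
      have "(u j)\<^sup>2 \<le> (1 - u j)\<^sup>2" using u[of j] by (intro power_mono) auto
      then have "(\<Sum>i\<in>I. (x $ i - of_int (w i))\<^sup>2) \<le>
          (\<Sum>i\<in>I. (x $ i - of_int (r i))\<^sup>2) - (x $ j - of_int (r j))\<^sup>2 + (x $ j - of_int r')\<^sup>2"
        by (intro sum_fun_upd_square[OF ij(2) w(1)]) (simp only: uj uj')
      also have "\<dots> = (\<Sum>k\<in>I. (u k)\<^sup>2) + (1 - 2 * u j)"
        unfolding uj uj' by (simp add: u_def) (simp add: power2_eq_square algebra_simps)
      finally show ?thesis using far'[OF w(2)] by simp
    qed
    moreover have "hole_radius2 \<le> (\<Sum>k\<in>I. (1/2 - u k)\<^sup>2) + 2 * u i + a * (1 - t)\<^sup>2"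
    proof -
      \<comment> \<open>The floor, so that \<open>y i + 1/2\<close> is a nearest point of Z + 1/2,
        at distance \<open>1/2 - u i\<close>; the alternative \<open>y'\<close> gives one at
        distance \<open>1/2 + u i\<close>.\<close>
      define y where "y i = (if x $ i \<ge> of_int (r i) then r i else r i - 1)" for i
      define y' where "y' = (if x $ i \<ge> of_int (r i) then r i - 1 else r i)"
      have uk: "(x $ k - (of_int (y k) + 1/2))\<^sup>2 = (1/2 - u k)\<^sup>2" for k
        by (auto simp: u_def y_def power2_eq_square algebra_simps)
      have ui': "(x $ i - (of_int y' + 1/2))\<^sup>2 = (1/2 + u i)\<^sup>2"
        by (auto simp: u_def y'_def power2_eq_square algebra_simps)
      obtain w where w: "w = y \<or> w = y(i := y')" "even ((\<Sum>i\<in>I. w i) + 1)"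
        by (rule parity_choice[OF ij(1), of y' y 1]) (simp add: y_def y'_def)
      have "(1/2 - u i)\<^sup>2 \<le> (1/2 + u i)\<^sup>2" using u[of i] by (intro power_mono) auto
      then have "(\<Sum>i\<in>I. (x $ i - (of_int (w i) + 1/2))\<^sup>2) \<le>
          (\<Sum>i\<in>I. (x $ i - (of_int (y i) + 1/2))\<^sup>2) - (x $ i - (of_int (y i) + 1/2))\<^sup>2
            + (x $ i - (of_int y' + 1/2))\<^sup>2"
        by (intro sum_fun_upd_square[OF ij(1) w(1), where f = "\<lambda>k. of_int k + 1/2"]) (simp only: uk ui')
      also have "\<dots> = (\<Sum>k\<in>I. (1/2 - u k)\<^sup>2) + 2 * u i"
        unfolding uk ui' by (simp add: power2_eq_square algebra_simps)
      finally show ?thesis using far'[OF w(2)] by (simp add: power2_commute[of t])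
    qed
    ultimately have "(1 - t) * hole_radius2 + t * hole_radius2 \<le>
        (1 - t) * ((\<Sum>k\<in>I. (u k)\<^sup>2) + (1 - 2 * u j) + a * t\<^sup>2) +
        t * ((\<Sum>k\<in>I. (1/2 - u k)\<^sup>2) + 2 * u i + a * (1 - t)\<^sup>2)"
      using t by (intro add_mono mult_left_mono) (auto simp: t_def)
    then show "hole_radius2 \<le> (1 - t) * ((\<Sum>k\<in>I. (u k)\<^sup>2) + (1 - 2 * u j) + a * t\<^sup>2) +
        t * ((\<Sum>k\<in>I. (1/2 - u k)\<^sup>2) + 2 * u i + a * (1 - t)\<^sup>2)"
      by (simp only: left_diff_distrib)
  qed (use u first_in_I in \<open>auto simp: card_I\<close>)
  \<comment> \<open>The squared distance to a lattice point that differs from x only by height 1 -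
    s; it rules out the wrong parity below.\<close>
  moreover have near: "a * (1 - s)\<^sup>2 < hole_radius2"
    by (simp add: hole_radius2_eq s_def)
  ultimately show "\<exists>u\<in>L_lattice e. x = u + deep_hole \<or> x = u - deep_hole"
  proof (elim disjE conjE)
    assume half: "\<forall>i\<in>I. u i = 1/2" and ts: "t = s"
    define y where "y i = (if x $ i \<ge> of_int (r i) then r i else r i - 1)" for i
    have y: "x $ i = of_int (y i) + 1/2" if "i \<in> I" for i
      using bspec[OF half that] by (auto simp: u_def y_def split: if_splits)
    have ev: "even (\<Sum>i\<in>I. y i)"
    proof (rule ccontr)
      assume "odd (\<Sum>i\<in>I. y i)"
      then have "even ((\<Sum>i\<in>I. y i) + 1)" by simp
      from far'[OF this] have "hole_radius2 \<le> a * (t - 1)\<^sup>2" by (simp add: y)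
      with near show False by (simp add: ts power2_commute)
    qed
    have "x + deep_hole \<in> L_lattice e"
      by (rule L_latticeI[of y 0])
         (use ev ts y in \<open>auto simp: deep_hole_def t_def s_def\<close>)
    then show ?thesis by (intro bexI[of _ "x + deep_hole"]) auto
  next
    assume zero: "\<forall>i\<in>I. u i = 0" and ts: "t = 1 - s"
    have y: "x $ i = of_int (r i)" if "i \<in> I" for i
      using bspec[OF zero that] by (simp add: u_def)
    have ev: "odd (\<Sum>i\<in>I. r i)"
    proof (rule ccontr)
      assume "\<not> odd (\<Sum>i\<in>I. r i)"
      then have "even ((\<Sum>i\<in>I. r i) + 0)" by simp
      from far'[OF this] have "hole_radius2 \<le> a * t\<^sup>2" by (simp add: y)
      with near show False by (simp add: ts)
    qed
    have "x - deep_hole \<in> L_lattice e"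
      by (rule L_latticeI[of r 1])
         (use ev ts y in \<open>auto simp: deep_hole_def t_def s_def\<close>)
    then show ?thesis by (intro bexI[of _ "x - deep_hole"]) auto
  qed
qed

lemma cover:
  "(\<exists>v\<in>L_lattice e. qform (Q_mat e) (x - v) < hole_radius2) \<or>
    (\<exists>u\<in>L_lattice e. x = u + deep_hole \<or> x = u - deep_hole)"
proof -
  define k where "k = \<lfloor>x $ last_ix\<rfloor>"
  \<comment> \<open>A lattice vector of height k: with integer part k at the first coordinate, the
    parity sum is 2 k.\<close>
  define w :: "real^'n" where
    "w = (\<chi> i. if i = last_ix then of_int k else of_int (of_bool (i = e 1) * k) + of_int k / 2)"
  have "(\<Sum>i\<in>I. of_bool (i = e 1) * k) = k"
    using first_in_I by (simp add: of_bool_def if_distrib[of "\<lambda>x. x * _"] cong: if_cong)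
  then have w: "w \<in> L_lattice e"
    by (intro L_latticeI[of "\<lambda>i. of_bool (i = e 1) * k" k]) (auto simp: w_def)
  have "0 \<le> (x - w) $ last_ix" "(x - w) $ last_ix \<le> 1"
    unfolding w_def k_def by (simp_all) linarith
  from cover_slab[OF this] show ?thesis
  proof (elim disjE bexE)
    fix v assume "v \<in> L_lattice e" "qform (Q_mat e) (x - w - v) < hole_radius2"
    then show ?thesis using L_lattice_add[OF w]
      by (intro disjI1 bexI[of _ "w + v"]) (auto simp: diff_diff_eq)
  next
    fix u assume u: "u \<in> L_lattice e" "x - w = u + deep_hole"
    then have "x = w + u + deep_hole" by (simp add: diff_eq_eq algebra_simps)
    then show ?thesis using L_lattice_add[OF w u(1)] by blast
  next
    fix u assume u: "u \<in> L_lattice e" "x - w = u - deep_hole"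
    then have "x = w + u - deep_hole" by (simp add: diff_eq_eq algebra_simps)
    then show ?thesis using L_lattice_add[OF w u(1)] by blast
  qed
qed

end

section \<open>The Delaunay polytope of the deep hole\<close>

context index_enumeration begin

definition layer_vec :: "real \<Rightarrow> ('n \<Rightarrow> real) \<Rightarrow> real^'n"
  where "layer_vec z f = (\<chi> i. if i = last_ix then z else f i)"

text \<open>Vertices relative to the hole, taken from the lattice layers 0, -1 and 1 in this order;
  the shift by \<open>hole_height\<close> converts a layer number into a relative height.\<close>

definition hole_vertices :: "(real^'n) set" where
  "hole_vertices =
    (\<lambda>S. layer_vec hole_height (\<lambda>i. cube_sign S i / 2)) ` even_subsets I \<union>
    (\<lambda>(i, \<sigma>). layer_vec (hole_height - 1) (\<lambda>j. \<sigma> * of_bool (j = i))) ` (I \<times> {1, -1}) \<union>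
    (if even n then {layer_vec (hole_height + 1) (\<lambda>_. 0)}
     else (\<lambda>(i, \<sigma>). layer_vec (hole_height + 1) (\<lambda>j. \<sigma> * of_bool (j = i))) ` (I \<times> {1, -1}))"

lemma layer_vec_nth: "layer_vec z f $ last_ix = z" "i \<in> I \<Longrightarrow> layer_vec z f $ i = f i"
  by (auto simp: layer_vec_def)

lemma finite_hole_vertices: "finite hole_vertices"
  by (simp add: hole_vertices_def finite_even_subsets)

lemma hole_vertices_nonempty: "hole_vertices \<noteq> {}"
  using first_in_I by (auto simp: hole_vertices_def)

lemma even_s: "even n \<Longrightarrow> 2 * a * hole_height = 1 / 2"
  using a_ge by (simp add: hole_height_def)

lemma odd_s: "odd n \<Longrightarrow> hole_height = 0"
  by (simp add: hole_height_def)

lemma hole_vertices_cases [consumes 1, case_names half lower apex upper]: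
  assumes "p \<in> hole_vertices"
  obtains S where "S \<in> even_subsets I" "p = layer_vec hole_height (\<lambda>i. cube_sign S i / 2)"
    | i \<sigma> where "i \<in> I" "\<sigma> = 1 \<or> \<sigma> = -1" "p = layer_vec (hole_height - 1) (\<lambda>j. \<sigma> * of_bool (j = i))"
    | "even n" "p = layer_vec (hole_height + 1) (\<lambda>_. 0)"
    | i \<sigma> where "odd n" "i \<in> I" "\<sigma> = 1 \<or> \<sigma> = -1" "p = layer_vec (hole_height + 1) (\<lambda>j. \<sigma> * of_bool (j = i))"
  using assms unfolding hole_vertices_def
proof (elim UnE)
  assume "p \<in> (if even n then {layer_vec (hole_height + 1) (\<lambda>_. 0)}
     else (\<lambda>(i, \<sigma>). layer_vec (hole_height + 1) (\<lambda>j. \<sigma> * of_bool (j = i))) ` (I \<times> {1, -1}))"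
  then show thesis using that(3,4) by (cases "even n") force+
qed (use that(1,2) in force)+

lemma sum_unit: "i \<in> I \<Longrightarrow> (\<Sum>j\<in>I. g j * of_bool (j = i)) = (g i :: 'b :: comm_semiring_1)"
  by (simp add: of_bool_def if_distrib[of "\<lambda>x. _ * x"] cong: if_cong)

lemma qform_Q_layer_vec:
  "qform (Q_mat e) (layer_vec z f) = (\<Sum>i\<in>I. (f i)\<^sup>2) + a * z\<^sup>2"
  by (simp add: qform_Q layer_vec_def)

lemma qform_hole_vertices:
  assumes "p \<in> hole_vertices"
  shows "qform (Q_mat e) p = hole_radius2"
  using assms
proof (cases rule: hole_vertices_cases)
  case (half S)
  have "(cube_sign S i / 2)\<^sup>2 = 1 / 4" for i
    by (simp add: power2_eq_square)
  then have "(\<Sum>i\<in>I. (cube_sign S i / 2)\<^sup>2) = (\<Sum>i\<in>I. 1 / 4)"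
    by (intro sum.cong refl)
  then show ?thesis
    by (simp add: half(2) qform_Q_layer_vec hole_radius2_def card_I)
next
  case (lower i \<sigma>)
  have "(\<sigma> * of_bool (j = i))\<^sup>2 = 1 * of_bool (j = i)" for j
    using lower(2) by auto
  then have "(\<Sum>j\<in>I. (\<sigma> * of_bool (j = i))\<^sup>2) = 1"
    using sum_unit[OF lower(1), of "\<lambda>_. 1 :: real"] by simp
  then show ?thesis
    by (simp add: lower(3) qform_Q_layer_vec hole_radius2_eq power2_commute)
next
  case apex
  then show ?thesis using even_s[OF apex(1)]
    by (simp add: qform_Q_layer_vec hole_radius2_eq power2_eq_square algebra_simps)
next
  case (upper i \<sigma>)
  have "(\<sigma> * of_bool (j = i))\<^sup>2 = 1 * of_bool (j = i)" for j
    using upper(3) by auto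
  then have "(\<Sum>j\<in>I. (\<sigma> * of_bool (j = i))\<^sup>2) = 1"
    using sum_unit[OF upper(2), of "\<lambda>_. 1 :: real"] by simp
  then show ?thesis
    by (simp add: upper(4) qform_Q_layer_vec hole_radius2_eq odd_s[OF upper(1)])
qed

text \<open>Parity decides the shape of each layer. In layer -1 the integer part must have odd sum,
  so the point straight below the hole is missing and its unit shifts appear. In layer 1 the point
  straight above has integer part all -1, with sum -(n - 1); it is admissible exactly for even n,
  and for odd n again only its unit shifts are.\<close>

lemma hole_vertices_in_lattice:
  assumes "p \<in> hole_vertices"
  shows "deep_hole + p \<in> L_lattice e"
  using assms
proof (cases rule: hole_vertices_cases)
  case (half S)
  have "S \<subseteq> I" "even (card S)" using half(1) by (auto simp: even_subsets_def)
  moreover have "(\<Sum>i\<in>I. - of_bool (i \<in> S) :: int) = - int (card (S \<inter> I))"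
    by (simp add: sum_negf of_bool_def sum.If_cases Int_commute)
  ultimately have "even ((\<Sum>i\<in>I. - of_bool (i \<in> S) :: int) + 0)"
    by (simp add: Int_absorb2)
  then show ?thesis
    by (rule L_latticeI) (auto simp: half(2) deep_hole_def layer_vec_def cube_sign_def)
next
  case (lower i \<sigma>)
  define \<tau> :: int where "\<tau> = (if \<sigma> = 1 then 1 else -1)"
  have \<tau>: "\<sigma> = of_int \<tau>" "odd \<tau>" using lower(2) by (auto simp: \<tau>_def)
  then have "even ((\<Sum>j\<in>I. \<tau> * of_bool (j = i)) + (-1))"
    unfolding sum_unit[OF lower(1), of "\<lambda>_. \<tau>"] by simp
  then show ?thesis
    by (rule L_latticeI) (auto simp: lower(3) deep_hole_def layer_vec_def \<tau>(1))
next
  case apex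
  have "even ((\<Sum>j\<in>I. -1) + (1 :: int))"
    using apex(1) n_ge_6 by (simp add: card_I of_nat_diff)
  then show ?thesis
    by (rule L_latticeI) (auto simp: apex(2) deep_hole_def layer_vec_def)
next
  case (upper i \<sigma>)
  define \<tau> :: int where "\<tau> = (if \<sigma> = 1 then 1 else -1)"
  have \<tau>: "\<sigma> = of_int \<tau>" "odd \<tau>" using upper(3) by (auto simp: \<tau>_def)
  have "(\<Sum>j\<in>I. \<tau> * of_bool (j = i) - 1) = \<tau> - int (n - 1)"
    unfolding sum_subtractf sum_unit[OF upper(2), of "\<lambda>_. \<tau>"] by (simp add: card_I)
  then have "even ((\<Sum>j\<in>I. \<tau> * of_bool (j = i) - 1) + 1)"
    using \<tau>(2) upper(1) n_ge_6 by (simp add: of_nat_diff)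
  then show ?thesis
    by (rule L_latticeI) (auto simp: upper(4) deep_hole_def layer_vec_def \<tau>(1))
qed

section \<open>Transport to Euclidean space by a square root of \<open>Q_mat e\<close>\<close>

definition scale_mat :: "real^'n^'n"
  where "scale_mat = (\<chi> i j. if i = j then if i = last_ix then sqrt a else 1 else 0)"

lemma scale_mat_nth: "(scale_mat *v x) $ i = (if i = last_ix then sqrt a else 1) * x $ i"
  by (simp add: scale_mat_def matrix_vector_mult_def if_distrib[of "\<lambda>x. x * _"] cong: if_cong)

lemma scale_mat_layer_vec: "scale_mat *v layer_vec z f = layer_vec (sqrt a * z) f"
  by (simp add: vec_eq_iff scale_mat_nth layer_vec_def)

lemma norm_scale_mat: "(norm (scale_mat *v x))\<^sup>2 = qform (Q_mat e) x"
  unfolding power2_norm_eq_inner inner_vec_def split_last qform_Q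
  using a_ge by (simp add: scale_mat_nth power_mult_distrib flip: power2_eq_square)

lemma Q_mat_eq: "Q_mat e = transpose scale_mat ** scale_mat"
  using a_ge
  by (simp add: vec_eq_iff Q_mat_def transpose_def matrix_matrix_mult_def scale_mat_def card_n
      if_distrib[of "\<lambda>x. x * _"] cong: if_cong)

lemma invertible_scale_mat: "invertible scale_mat"
proof -
  have "x = 0" if "scale_mat *v x = 0" for x
  proof -
    have "x $ i = 0" for i
      using that a_ge scale_mat_nth[of x i] by (cases "i = last_ix") auto
    then show ?thesis by (simp add: vec_eq_iff)
  qed
  then show ?thesis
    unfolding invertible_left_inverse matrix_left_invertible_ker by blast
qed

lemma Q_mat_pos_def: "Q_mat e \<in> pos_def_forms"
  using pos_def_congruence[OF mat_1_pos_def invertible_scale_mat] by (simp add: Q_mat_eq)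

text \<open>\<open>X\<close>, \<open>Y\<close> and \<open>Z\<close> come from averaging the rigidity
  brackets over the layers 0, -1 and 1. Here T is the trace over \<open>I\<close>, \<eta> and
  \<delta> are rescaled last entries of H and d, and \<open>a * T = - \<eta>\<close> is the trace
  condition.\<close>

lemma rigid_inequalities:
  fixes T \<eta> \<delta> s :: real
  assumes s: "s = hole_height" and T: "a * T = - \<eta>"
    and X: "\<eta> * s\<^sup>2 - 2 * \<delta> * s + T / 4 \<ge> 0"
    and Y: "T + m * (\<eta> * (s - 1)\<^sup>2 - 2 * \<delta> * (s - 1)) \<ge> 0"
    and Z: "if even n then \<eta> * (s + 1)\<^sup>2 - 2 * \<delta> * (s + 1) \<ge> 0
      else T + m * (\<eta> * (s + 1)\<^sup>2 - 2 * \<delta> * (s + 1)) \<ge> 0"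
  shows "\<eta> = 0" "\<delta> = 0" "T = 0"
proof -
  have a: "a > 0" using a_ge by linarith
  have "\<eta> = 0 \<and> \<delta> = 0"
  proof (cases "even n")
    case True
    have s0: "0 < s" "s \<le> 1/3" using hole_height_bounds even_s[OF True] by (auto simp: s less_le)
    have as: "4 * a * s = 1" using even_s[OF True] by (simp add: s)
    have "m * s = (2 + 4 * a) * s" using hole_height_eq even_s[OF True] by simp
    then have ms: "m * s = 2 * s + 1" using as by (simp add: algebra_simps)
    have Ts: "T = - 4 * s * \<eta>" using T as by algebra
    \<comment> \<open>With T eliminated, \<open>X\<close> reads \<open>- s * A \<ge> 0\<close>, and
      the bracket in \<open>Y\<close> equals \<open>(1 - s) * A\<close>. So
      \<open>A \<le> 0\<close>, and \<open>Y\<close> then gives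
      \<open>\<eta> \<le> 0\<close>.\<close>
    define A where "A = \<eta> * (1 - s) + 2 * \<delta>"
    have "0 \<le> s * (- A)" using X by (simp add: Ts A_def power2_eq_square algebra_simps)
    then have A: "A \<le> 0" using s0 by (simp add: mult_le_0_iff)
    have "0 \<le> s * (T + m * (\<eta> * (s - 1)\<^sup>2 - 2 * \<delta> * (s - 1)))" using Y s0 by simp
    also have "\<dots> = s * T + (m * s) * ((1 - s) * A)"
      by (simp add: A_def power2_eq_square algebra_simps)
    finally have "0 \<le> s * T + (2 * s + 1) * ((1 - s) * A)" unfolding ms .
    then have Y': "0 \<le> - 4 * s\<^sup>2 * \<eta> + (2 * s + 1) * ((1 - s) * A)"
      by (simp add: Ts power2_eq_square mult_ac)
    have pos: "0 < (2 * s + 1) * (1 - s)" using s0 by simp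
    then have "(2 * s + 1) * ((1 - s) * A) \<le> 0"
      using A by (simp add: mult.assoc[symmetric] mult_nonneg_nonpos)
    then have "s\<^sup>2 * \<eta> \<le> 0" using Y' by simp
    then have eta: "\<eta> \<le> 0" using s0 by (simp add: mult_le_0_iff)
    have "0 \<le> (s + 1) * (\<eta> * (s + 1) - 2 * \<delta>)"
      using Z True by (simp add: power2_eq_square algebra_simps)
    moreover have "0 < s + 1" using s0 by simp
    ultimately have "0 \<le> \<eta> * (s + 1) - 2 * \<delta>"
      by (meson mult_pos_neg not_le)
    \<comment> \<open>The apex inequality bounds A by \<eta>; inserted into \<open>Y\<close>, it
      leaves \<eta> times a factor that is positive for 0 < s \<le> 1/3, and hence the reverse
      sign.\<close>
    then have "A \<le> 2 * \<eta>" by (simp add: A_def algebra_simps)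
    then have "(2 * s + 1) * (1 - s) * A \<le> (2 * s + 1) * (1 - s) * (2 * \<eta>)"
      using pos by (intro mult_left_mono) auto
    then have "0 \<le> - 4 * s\<^sup>2 * \<eta> + (2 * s + 1) * (1 - s) * (2 * \<eta>)"
      using Y' unfolding mult.assoc[symmetric] by linarith
    also have "\<dots> = \<eta> * (2 + 2 * s - 8 * s\<^sup>2)" by (simp add: power2_eq_square algebra_simps)
    finally have prod: "0 \<le> \<eta> * (2 + 2 * s - 8 * s\<^sup>2)" .
    have "s * s \<le> 1/3 * s" using s0 by (intro mult_right_mono) auto
    then have "0 < 2 + 2 * s - 8 * s\<^sup>2"
      using s0 unfolding power2_eq_square by linarith
    then have "\<eta> \<ge> 0" using prod by (simp add: zero_le_mult_iff)
    with eta have "\<eta> = 0" by simp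
    moreover from this have "0 \<le> (2 * s + 1) * (1 - s) * A" using Y' by (simp add: mult.assoc)
    then have "A \<ge> 0" using pos by (simp add: zero_le_mult_iff)
    ultimately show ?thesis using A by (simp add: A_def)
  next
    case False
    then have s0: "s = 0" by (simp add: s odd_s)
    have "T \<ge> 0" using X s0 by simp
    then have "0 \<le> a * T" using a by simp
    then have eta: "\<eta> \<le> 0" using T by simp
    \<comment> \<open>For s = 0 the heights are -1 and 1, so adding \<open>Y\<close> and
      \<open>Z\<close> cancels \<delta>. Since \<open>a * m\<close> exceeds 1, the sum gives the
      sign of \<eta> opposite to the one from \<open>X\<close>.\<close>
    have "0 \<le> 2 * T + 2 * m * \<eta>" using Y Z False s0 by (simp add: algebra_simps)
    then have "0 \<le> a * (2 * T + 2 * m * \<eta>)" using a by simp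
    also have "\<dots> = 2 * ((a * m - 1) * \<eta>)" using T by (simp add: algebra_simps)
    finally have "0 \<le> (a * m - 1) * \<eta>" by linarith
    moreover have "1 / 2 * 5 \<le> a * m" using a_ge m_ge_5 by (intro mult_mono) auto
    ultimately have "\<eta> \<ge> 0" unfolding zero_le_mult_iff by linarith
    with eta have "\<eta> = 0" by simp
    moreover from this have "T = 0" using T a by simp
    ultimately have "\<delta> = 0"
      using Y Z False s0 n_ge_6 by (auto simp: zero_le_mult_iff mult_le_0_iff)
    with \<open>\<eta> = 0\<close> show ?thesis by simp
  qed
  then show "\<eta> = 0" "\<delta> = 0" "T = 0" using T a by auto
qed

lemma qform_layer_vec:
  assumes "transpose H = H"
  shows "qform H (layer_vec z f) - 2 * (d \<bullet> layer_vec z f) =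
    (\<Sum>i\<in>I. \<Sum>j\<in>I. H $ i $ j * (f i * f j)) + 2 * z * (\<Sum>i\<in>I. H $ i $ last_ix * f i)
    + H $ last_ix $ last_ix * z\<^sup>2 - 2 * (\<Sum>i\<in>I. d $ i * f i) - 2 * d $ last_ix * z"
proof -
  have sym: "H $ i $ j = H $ j $ i" for i j
    using assms by (metis transpose_def vec_lambda_beta)
  have row: "(\<Sum>j\<in>I. H $ last_ix $ j * z * f j) = z * (\<Sum>i\<in>I. H $ i $ last_ix * f i)"
    unfolding sum_distrib_left by (intro sum.cong refl) (subst sym, simp)
  have col: "(\<Sum>i\<in>I. H $ i $ last_ix * f i * z) = z * (\<Sum>i\<in>I. H $ i $ last_ix * f i)"
    unfolding sum_distrib_left by (intro sum.cong refl) simp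
  have "qform H (layer_vec z f) = H $ last_ix $ last_ix * z * z + (\<Sum>j\<in>I. H $ last_ix $ j * z * f j)
      + (\<Sum>i\<in>I. H $ i $ last_ix * f i * z + (\<Sum>j\<in>I. H $ i $ j * f i * f j))"
    by (simp add: qform_sum split_last layer_vec_nth)
  then have "qform H (layer_vec z f) =
    (\<Sum>i\<in>I. \<Sum>j\<in>I. H $ i $ j * (f i * f j)) + 2 * z * (\<Sum>i\<in>I. H $ i $ last_ix * f i)
    + H $ last_ix $ last_ix * z\<^sup>2"
    unfolding sum.distrib row col by (simp add: power2_eq_square mult.assoc)
  moreover have "d \<bullet> layer_vec z f = (\<Sum>i\<in>I. d $ i * f i) + d $ last_ix * z"
    by (simp add: inner_vec_def split_last layer_vec_def)
  ultimately show ?thesis by simp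
qed

text \<open>The layer averages vanish first. The nonnegative quantities that were averaged are then
  zero individually, and the resulting equalities on the cross polytope and the half cube determine
  all remaining entries.\<close>

lemma hole_vertices_rigid:
  assumes H: "transpose H = H" "trace H = 0"
    and ge: "\<And>p. p \<in> hole_vertices \<Longrightarrow> 0 \<le> qform H (scale_mat *v p) - 2 * (d \<bullet> (scale_mat *v p))"
  shows "H = 0 \<and> d = 0"
proof -
  let ?E = "even_subsets I"
  define s where "s = hole_height"
  define r where "r = sqrt a"
  have r: "r > 0" "r * r = a" using a_ge by (auto simp: r_def)
  define \<eta> \<delta> T where "\<eta> = a * H $ last_ix $ last_ix" and "\<delta> = r * d $ last_ix"
    and "T = (\<Sum>i\<in>I. H $ i $ i)"
  define h where "h i = r * H $ i $ last_ix" for i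
  \<comment> \<open>The rigidity bracket at the Euclidean image of \<open>layer_vec z f\<close>; the
    factor sqrt a of the last coordinate is absorbed into \<eta>, \<delta> and
    \<open>h\<close>.\<close>
  define val where "val z f = (\<Sum>i\<in>I. \<Sum>j\<in>I. H $ i $ j * (f i * f j)) + 2 * z * (\<Sum>i\<in>I. h i * f i)
      + \<eta> * z\<^sup>2 - 2 * (\<Sum>i\<in>I. d $ i * f i) - 2 * \<delta> * z" for z f
  have val: "0 \<le> val z f" if "layer_vec z f \<in> hole_vertices" for z f
    using ge[OF that] unfolding scale_mat_layer_vec qform_layer_vec[OF H(1)] r_def[symmetric]
    by (simp add: val_def h_def \<eta>_def \<delta>_def r(2)[symmetric] sum_distrib_left
        power2_eq_square mult_ac)
  have "T = - H $ last_ix $ last_ix"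
    using H(2) unfolding trace_def split_last T_def by linarith
  then have aT: "a * T = - \<eta>" by (simp add: \<eta>_def)
  have finI: "finite I" by simp
  have card5: "card I \<ge> 5" using n_ge_6 by (simp add: card_I)
  have half: "0 \<le> val s (\<lambda>i. cube_sign S i / 2)" if "S \<in> ?E" for S
    using that by (intro val) (auto simp: hole_vertices_def s_def)
  have half_eq: "val s (\<lambda>i. cube_sign S i / 2) = (\<eta> * s\<^sup>2 - 2 * \<delta> * s) +
      (\<Sum>i\<in>I. (s * h i - d $ i) * cube_sign S i) +
      (\<Sum>i\<in>I. \<Sum>j\<in>I. H $ i $ j / 4 * (cube_sign S i * cube_sign S j))" for S
    by (simp add: val_def sum_subtractf sum_distrib_left algebra_simps)
  have half_sum: "(\<Sum>S\<in>?E. val s (\<lambda>i. cube_sign S i / 2)) =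
      real (card ?E) * (\<eta> * s\<^sup>2 - 2 * \<delta> * s + T / 4)"
    unfolding half_eq sum_even_cube_quadratic[OF finI card5]
    by (simp add: T_def sum_divide_distrib)
  have N: "real (card ?E) > 0" using card_even_subsets_pos[of I] by simp
  have X: "0 \<le> \<eta> * s\<^sup>2 - 2 * \<delta> * s + T / 4"
  proof -
    have "0 \<le> (\<Sum>S\<in>?E. val s (\<lambda>i. cube_sign S i / 2))" by (intro sum_nonneg half)
    then show ?thesis using N unfolding half_sum zero_le_mult_iff by linarith
  qed
  have unit_eq: "val z (\<lambda>j. \<sigma> * of_bool (j = i)) =
      H $ i $ i + \<eta> * z\<^sup>2 - 2 * \<delta> * z + 2 * \<sigma> * (z * h i - d $ i)"
    if "i \<in> I" "\<sigma> = 1 \<or> \<sigma> = -1" for i z \<sigma>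
  proof -
    have "(\<Sum>k\<in>I. \<Sum>j\<in>I. H $ k $ j * (\<sigma> * of_bool (k = i) * (\<sigma> * of_bool (j = i)))) =
        (\<Sum>k\<in>I. (\<Sum>j\<in>I. (\<sigma> * \<sigma> * H $ k $ j) * of_bool (j = i)) * of_bool (k = i))"
      by (simp add: sum_distrib_left sum_distrib_right mult_ac)
    also have "\<dots> = \<sigma> * \<sigma> * H $ i $ i" by (simp only: sum_unit[OF that(1)])
    also have "\<dots> = H $ i $ i" using that(2) by auto
    finally show ?thesis
      unfolding val_def using sum_unit[OF that(1), of "\<lambda>j. h j * \<sigma>"] sum_unit[OF that(1), of "\<lambda>j. d $ j * \<sigma>"]
      by (simp add: algebra_simps)
  qed
  have lower: "0 \<le> val (s - 1) (\<lambda>j. \<sigma> * of_bool (j = i))" if "i \<in> I" "\<sigma> = 1 \<or> \<sigma> = -1" for i \<sigma>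
    using that by (intro val) (auto simp: hole_vertices_def s_def image_iff intro!: bexI[of _ i])
  \<comment> \<open>Opposite vertices of a cross polytope cancel the terms linear in the sign;
    summing over \<open>I\<close> then leaves the trace.\<close>
  have avg: "0 \<le> T + m * (\<eta> * z\<^sup>2 - 2 * \<delta> * z)"
    if "\<And>i \<sigma>. i \<in> I \<Longrightarrow> \<sigma> = 1 \<or> \<sigma> = -1 \<Longrightarrow> 0 \<le> val z (\<lambda>j. \<sigma> * of_bool (j = i))" for z
  proof -
    have "0 \<le> (\<Sum>i\<in>I. H $ i $ i + (\<eta> * z\<^sup>2 - 2 * \<delta> * z))"
    proof (rule sum_nonneg)
      fix i assume i: "i \<in> I"
      show "0 \<le> H $ i $ i + (\<eta> * z\<^sup>2 - 2 * \<delta> * z)"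
        using that[OF i, of 1] that[OF i, of "-1"] unit_eq[OF i, of 1 z] unit_eq[OF i, of "-1" z] by simp
    qed
    then show ?thesis by (simp add: sum.distrib T_def card_I)
  qed
  have Y: "0 \<le> T + m * (\<eta> * (s - 1)\<^sup>2 - 2 * \<delta> * (s - 1))" by (rule avg) (rule lower)
  have Z: "if even n then \<eta> * (s + 1)\<^sup>2 - 2 * \<delta> * (s + 1) \<ge> 0
      else T + m * (\<eta> * (s + 1)\<^sup>2 - 2 * \<delta> * (s + 1)) \<ge> 0"
  proof (cases "even n")
    case True
    then have "0 \<le> val (s + 1) (\<lambda>_. 0)" by (intro val) (auto simp: hole_vertices_def s_def)
    then show ?thesis using True by (simp add: val_def)
  next
    case False
    have "0 \<le> T + m * (\<eta> * (s + 1)\<^sup>2 - 2 * \<delta> * (s + 1))"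
    proof (rule avg)
      fix i :: 'n and \<sigma> :: real assume "i \<in> I" "\<sigma> = 1 \<or> \<sigma> = -1"
      then show "0 \<le> val (s + 1) (\<lambda>j. \<sigma> * of_bool (j = i))"
        using False by (intro val) (auto simp: hole_vertices_def s_def image_iff intro!: bexI[of _ i])
    qed
    then show ?thesis using False by simp
  qed
  have zero: "\<eta> = 0" "\<delta> = 0" "T = 0"
    using rigid_inequalities[OF s_def aT X Y Z] by auto
  have Hii_ge: "0 \<le> H $ i $ i" if "i \<in> I" for i
    using lower[OF that, of 1] lower[OF that, of "-1"] unit_eq[OF that, of 1 "s - 1"]
      unit_eq[OF that, of "-1" "s - 1"] by (simp add: zero)
  \<comment> \<open>Nonnegative diagonal entries with sum T = 0.\<close>
  then have Hii: "H $ i $ i = 0" if "i \<in> I" for i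
    using zero(3) that unfolding T_def by (subst (asm) sum_nonneg_eq_0_iff) auto
  \<comment> \<open>With the even part gone, the inequalities at two opposite vertices are negatives
    of each other, so the linear term is zero.\<close>
  have dh: "(s - 1) * h i = d $ i" if "i \<in> I" for i
    using lower[OF that, of 1] lower[OF that, of "-1"] unit_eq[OF that, of 1 "s - 1"]
      unit_eq[OF that, of "-1" "s - 1"] by (simp add: zero Hii[OF that])
  \<comment> \<open>The half-cube values are nonnegative with mean zero, so the moment argument
    applies to a polynomial that vanishes at all these vertices.\<close>
  have half0: "val s (\<lambda>i. cube_sign S i / 2) = 0" if "S \<in> ?E" for S
  proof -
    have "(\<Sum>S\<in>?E. val s (\<lambda>i. cube_sign S i / 2)) = 0" by (simp add: half_sum zero)
    then show ?thesis using half that finite_even_subsets[of I]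
      by (subst (asm) sum_nonneg_eq_0_iff) auto
  qed
  note cube = even_cube_quadratic_eq_0[OF finI card5 half0[unfolded half_eq]]
  \<comment> \<open>The half cube gives s h = d and the lower cross polytope gives (s - 1) h = d.
    The two layers differ by height 1, so h = 0 and then d = 0.\<close>
  have "s * h i - d $ i = 0" if "i \<in> I" for i using cube(1)[OF _ that] by simp
  then have h0: "h i = 0" if "i \<in> I" for i using dh[OF that] that by (simp add: algebra_simps)
  then have d0: "d $ i = 0" if "i \<in> I" for i using dh[OF that] that by simp
  have sym: "H $ i $ j = H $ j $ i" for i j
    using H(1) by (metis transpose_def vec_lambda_beta)
  have HI: "H $ i $ j = 0" if "i \<in> I" "j \<in> I" for i j
    using cube(2)[OF _ that] sym[of i j] Hii that by (cases "i = j") auto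
  have Hl: "H $ i $ last_ix = 0" if "i \<in> I" for i using h0[OF that] r(1) by (simp add: h_def)
  have Hll: "H $ last_ix $ last_ix = 0" using zero(1) r by (auto simp: \<eta>_def)
  have "H $ i $ j = 0" for i j
    using HI[of i j] Hl[of i] Hl[of j] Hll sym[of last_ix j]
    by (cases "i = last_ix"; cases "j = last_ix") auto
  moreover have "d $ i = 0" for i
    using d0[of i] zero(2) r(1) by (cases "i = last_ix") (auto simp: \<delta>_def)
  ultimately show ?thesis by (simp add: vec_eq_iff)
qed

lemma local_max_L_lattice:
  "local_max_pair covering_density (L_lattice e) (Q_mat e)"
  "local_max_pair inhom_hermite (L_lattice e) (Q_mat e)"
proof -
  obtain B where B: "lattice_basis B (L_lattice e)" using lattice_basis_exists by blast
  let ?c = "scale_mat *v deep_hole"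
  \<comment> \<open>The columns of \<open>S\<close> form a basis of the Euclidean copy of the
    lattice, and its Gram matrix is the form that represents the pair.\<close>
  define S where "S = scale_mat ** B"
  define \<Lambda> where "\<Lambda> = (\<lambda>x. scale_mat *v x) ` L_lattice e"
  define V where "V = (\<lambda>p. scale_mat *v (deep_hole + p)) ` hole_vertices"
  have inv: "invertible S" unfolding S_def
    using B invertible_scale_mat by (intro invertible_mult) (auto simp: lattice_basis_def)
  have \<Lambda>: "\<Lambda> = (\<lambda>z. S *v z) ` int_vecs"
    using B by (auto simp: \<Lambda>_def S_def lattice_basis_def image_image matrix_vector_mul_assoc)
  have V_diff: "scale_mat *v (deep_hole + p) - ?c = scale_mat *v p" for p
    by (simp add: matrix_vector_right_distrib)
  have fin: "finite V" "V \<noteq> {}" "V \<subseteq> \<Lambda>"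
    using finite_hole_vertices hole_vertices_nonempty hole_vertices_in_lattice
    by (auto simp: V_def \<Lambda>_def)
  have dist: "(norm (v - ?c))\<^sup>2 = hole_radius2" if "v \<in> V" for v
    using that by (auto simp: V_def V_diff norm_scale_mat qform_hole_vertices)
  have hole: "hole_radius2 \<le> (norm (?c - v))\<^sup>2" if v: "v \<in> \<Lambda>" for v
  proof -
    obtain x where x: "x \<in> L_lattice e" "v = scale_mat *v x" using v by (auto simp: \<Lambda>_def)
    have "(norm (?c - v))\<^sup>2 = (norm (scale_mat *v (x - deep_hole)))\<^sup>2"
      by (simp add: x(2) norm_minus_commute matrix_vector_mult_diff_distrib)
    then show ?thesis using deep_hole_empty_sphere[OF x(1)] by (simp add: norm_scale_mat)
  qed
  have cov: "(\<exists>v\<in>\<Lambda>. (norm (x - v))\<^sup>2 < hole_radius2) \<or> (\<exists>u\<in>\<Lambda>. x = u + ?c \<or> x = u - ?c)" for x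
  proof -
    obtain x' where x: "x = scale_mat *v x'"
      using invertible_scale_mat unfolding invertible_def
      by (metis matrix_vector_mul_assoc matrix_vector_mul_lid)
    from cover[of x'] show ?thesis
    proof (elim disjE bexE)
      fix v assume v: "v \<in> L_lattice e" "qform (Q_mat e) (x' - v) < hole_radius2"
      then have "(norm (x - scale_mat *v v))\<^sup>2 < hole_radius2"
        by (simp add: x norm_scale_mat flip: matrix_vector_mult_diff_distrib)
      then show ?thesis using v(1) by (auto simp: \<Lambda>_def)
    next
      fix u assume u: "u \<in> L_lattice e" "x' = u + deep_hole"
      then have "x = scale_mat *v u + ?c" by (simp add: x matrix_vector_right_distrib)
      then show ?thesis using u(1) by (auto simp: \<Lambda>_def)
    next
      fix u assume u: "u \<in> L_lattice e" "x' = u - deep_hole"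
      then have "x = scale_mat *v u - ?c" by (simp add: x matrix_vector_mult_diff_distrib)
      then show ?thesis using u(1) by (auto simp: \<Lambda>_def)
    qed
  qed
  have rigid: "H = 0 \<and> d = 0" if "transpose H = H" "trace H = 0"
    "\<And>v. v \<in> V \<Longrightarrow> 0 \<le> qform H (v - ?c) - 2 * (d \<bullet> (v - ?c))" for H d
  proof (rule hole_vertices_rigid[OF that(1,2)])
    fix p assume "p \<in> hole_vertices"
    then show "0 \<le> qform H (scale_mat *v p) - 2 * (d \<bullet> (scale_mat *v p))"
      using that(3)[of "scale_mat *v (deep_hole + p)"] unfolding V_diff by (simp add: V_def)
  qed
  have eq: "transpose S ** S = transpose B ** Q_mat e ** B"
    by (simp add: S_def Q_mat_eq matrix_transpose_mul matrix_mul_assoc)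
  have "local_max_form covering_density (transpose S ** S)"
    "local_max_form inhom_hermite (transpose S ** S)"
    by (rule local_max_of_rigid_hole[OF inv \<Lambda> hole_radius2_pos fin dist hole cov rigid]; assumption)+
  then show "local_max_pair covering_density (L_lattice e) (Q_mat e)"
    "local_max_pair inhom_hermite (L_lattice e) (Q_mat e)"
    using B unfolding local_max_pair_def eq by blast+
qed

end

theorem theorem7p1:
  fixes e :: "nat \<Rightarrow> 'n::finite"
  assumes "6 \<le> CARD('n)"
    and "bij_betw e {1..CARD('n)} UNIV"
  shows "Q_mat e \<in> pos_def_forms
    \<and> local_covering_max (L_lattice e) (Q_mat e)
    \<and> local_max_pair inhom_hermite (L_lattice e) (Q_mat e)"
proof -
  interpret index_enumeration e "CARD('n)" using assms by unfold_locales simp_all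
  show ?thesis
    unfolding local_covering_max_def using Q_mat_pos_def local_max_L_lattice by blast
qed

end
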